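(* Let $\Delta\subset\mathbb{R}^n$ be a nondegenerate $n$-simplex with faces $F_0,\dots,F_n$ and normalized outward normals $\mathbf{k}_0,\dots,\mathbf{k}_n$. Let $X$ be the affine space of all tuples $[p_0,p_1,\dots,p_n]$ such that each $p_i$ lies in the $(n-1)$-dimensional hyperplane containing $F_i$ and the matrix $A=\sum_{i=0}^n\mathbf{k}_ip_i^T$ is symmetric. Then $X$ has dimension $\frac12 n(n+1)-1$, the tuple $\mathcal{G}=[g_0,\dots,g_n]$ of centroids $g_i$ of the faces $F_i$ belongs to $X$, and there is an open neighbourhood $N$ of $\mathcal{G}$ in $X$ such that every contact set in $N$ immobilizes $\Delta$.
   Context: $\Delta$ has vertices $v_0,\dots,v_n$, ordered so that $\mathrm{vol}(\Delta)=\frac{1}{n!}\det[v_1-v_0,\dots,v_n-v_0]>0$. $F_i$ is the face of $\Delta$ opposite $v_i$ (with vertices $v_j$, $j\ne i$), and $g_i=\frac1n\sum_{j\neq i}v_j$ is its centroid. $\mathbf{k}_i$ is the outward pointing normal to $F_i$ with $|\mathbf{k}_i|=\mathrm{vol}(F_i)$ (the $(n-1)$-dimensional volume); then $\sum_{i=0}^n\mathbf{k}_i=\mathbf{0}$. Vectors are columns, so $A$ is an $n\times n$ matrix. $\mathbb{E}_n$ is the group of (orientation preserving) rigid motions $x\mapsto Rx+\underline{a}$ of $\mathbb{R}^n$, $R\in SO(n)$, with its usual topology. A set of points $p_i\in F_i$ ($i=0,\dots,n$) immobilizes $\Delta$ if there is a neighbourhood $U$ of the identity in $\mathbb{E}_n$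 such that for every $g\in U$, $g\neq I$, at least one $g(p_i)$ lies in the interior of $\Delta$. *)

theory Defs
  imports "HOL-Analysis.Analysis"
begin

text \<open>
  Lower-dimensional volume: the Lebesgue measure of \<open>S\<close>, computed inside its affine hull with
  respect to Cartesian coordinates, i.e. an origin \<open>a\<close> and an orthonormal basis \<open>B\<close> of the
  direction space. A point has volume 1 (the product measure over the empty index set).
\<close>

definition cartesian_frame :: "'a::euclidean_space set \<Rightarrow> 'a \<Rightarrow> 'a set \<Rightarrow> bool" where
  "cartesian_frame S a B \<longleftrightarrow>
     pairwise orthogonal B \<and> (\<forall>b\<in>B. norm b = 1) \<and> affine hull S = (\<lambda>x. a + x) ` span B"

definition relative_volume :: "'a::euclidean_space set \<Rightarrow> real" where
  "relative_volume S =
     (let (a, B) = (SOME (a, B). cartesian_frame S a B); M = PiM B (\<lambda>_. lborel :: real measure)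
      in measure M {c \<in> space M. a + (\<Sum>b\<in>B. c b *\<^sub>R b) \<in> S})"

text \<open>
  With \<open>n = CARD('n)\<close>, the vertices \<open>v\<^sub>0, \<dots>, v\<^sub>n\<close> are indexed by \<open>'n option\<close>: \<open>v None\<close> is \<open>v\<^sub>0\<close> and
  \<open>v (Some j)\<close>, \<open>j :: 'n\<close>, are \<open>v\<^sub>1, \<dots>, v\<^sub>n\<close>. The columns of the determinant below are indexed by
  the same type as its rows, so its sign does not depend on how \<open>'n\<close> is enumerated.
\<close>

definition signed_volume :: "('n option \<Rightarrow> real ^ 'n) \<Rightarrow> real" where
  "signed_volume v = det (\<chi> i j. (v (Some j) - v None) $ i) / fact CARD('n)"

definition nondegenerate_simplex :: "('n option \<Rightarrow> real ^ 'n) \<Rightarrow> bool" where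
  "nondegenerate_simplex v \<longleftrightarrow> inj v \<and> \<not> affine_dependent (range v)"

definition solid :: "('n option \<Rightarrow> real ^ 'n) \<Rightarrow> (real ^ 'n) set" where
  "solid v = convex hull (range v)"

definition facet :: "('n option \<Rightarrow> real ^ 'n) \<Rightarrow> 'n option \<Rightarrow> (real ^ 'n) set" where
  "facet v i = convex hull (v ` (UNIV - {i}))"

definition facet_centroid :: "('n option \<Rightarrow> real ^ 'n) \<Rightarrow> 'n option \<Rightarrow> real ^ 'n" where
  "facet_centroid v i = (1 / real CARD('n)) *\<^sub>R (\<Sum>j\<in>UNIV - {i}. v j)"

text \<open>
  The second conjunct says that \<open>k\<close> points out of the simplex (\<open>k \<noteq> 0\<close> by the third one).
  Orthogonality to the facet is void for \<open>n = 1\<close>, where facets are points.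
\<close>

definition normalized_outward_normal ::
    "('n option \<Rightarrow> real ^ 'n) \<Rightarrow> 'n option \<Rightarrow> real ^ 'n \<Rightarrow> bool" where
  "normalized_outward_normal v i k \<longleftrightarrow>
     (\<forall>x\<in>facet v i. \<forall>y\<in>facet v i. k \<bullet> (x - y) = 0) \<and>
     (\<forall>x\<in>facet v i. \<forall>y\<in>solid v. k \<bullet> (y - x) \<le> 0) \<and>
     norm k = relative_volume (facet v i)"

definition outer_product :: "real ^ 'n \<Rightarrow> real ^ 'n \<Rightarrow> real ^ 'n ^ 'n" where
  "outer_product x y = (columnvector x :: real ^ 1 ^ 'n) ** (rowvector y :: real ^ 'n ^ 1)"

definition equilibrium_space ::
    "('n option \<Rightarrow> real ^ 'n) \<Rightarrow> ('n option \<Rightarrow> real ^ 'n) \<Rightarrow> (real ^ 'n ^ 'n option) set" where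
  "equilibrium_space v k =
     {p. (\<forall>i. p $ i \<in> affine hull (facet v i)) \<and>
         (let A = (\<Sum>i\<in>UNIV. outer_product (k i) (p $ i)) in transpose A = A)}"

definition contact_set :: "('n option \<Rightarrow> real ^ 'n) \<Rightarrow> real ^ 'n ^ 'n option \<Rightarrow> bool" where
  "contact_set v p \<longleftrightarrow> (\<forall>i. p $ i \<in> facet v i)"

text \<open>
  The rigid motion \<open>x \<mapsto> R x + a\<close> is represented by the pair \<open>(R, a)\<close>, which it determines; the
  topology is that of \<open>SO(n) \<times> \<real>\<^sup>n\<close> as a subspace of matrices times vectors.
\<close>

definition rigid_motions :: "((real ^ 'n ^ 'n) \<times> (real ^ 'n)) set" where
  "rigid_motions = {(R, a). rotation_matrix R}"

definition apply_motion :: "(real ^ 'n ^ 'n) \<times> (real ^ 'n) \<Rightarrow> real ^ 'n \<Rightarrow> real ^ 'n" where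
  "apply_motion g x = fst g *v x + snd g"

definition immobilizes ::
    "real ^ 'n ^ 'n option \<Rightarrow> ('n option \<Rightarrow> real ^ 'n) \<Rightarrow> bool" where
  "immobilizes p v \<longleftrightarrow>
     (\<exists>U. openin (top_of_set rigid_motions) U \<and> (mat 1, 0) \<in> U \<and>
        (\<forall>g\<in>U. g \<noteq> (mat 1, 0) \<longrightarrow> (\<exists>i. apply_motion g (p $ i) \<in> interior (solid v))))"

end

theory Submission
  imports Defs
begin

text \<open>
  Let \<open>d i\<close> be the gradient of the \<open>i\<close>-th barycentric coordinate of the simplex. The normal \<open>k i\<close> is
  \<open>- c\<close> times \<open>d i\<close> with one constant \<open>c > 0\<close> for all facets (\<open>outward_normals_eq\<close>): the prisms
  over two facets along their common transversal edge are exchanged by a volume-preserving affine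
  involution, so facet volume divided by the length of the gradient does not depend on the facet.
  From here on only the duality between gradients and vertices is used: the \<open>d i\<close> sum to zero and
  \<open>\<Sum>\<^sub>i d i (v i)\<^sup>T\<close> is the identity. Consequently the tuple of centroids has the moment matrix
  \<open>\<Sum>\<^sub>i d i (g i)\<^sup>T = - (1/n) I\<close> (\<open>moment_centroids\<close>), which is symmetric and negative definite.

  For the dimension, write a tuple in the facet hyperplanes as the centroids plus a tuple \<open>q\<close> with
  \<open>q i\<close> orthogonal to \<open>d i\<close>. On such tuples the map \<open>q \<mapsto> \<Sum>\<^sub>i d i (q i)\<^sup>T\<close> is a bijection onto the
  traceless matrices (\<open>moment_kernel\<close>, \<open>moment_surjective\<close>), so the directions of the
  equilibrium space correspond to the symmetric traceless matrices, a space of dimension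
  \<open>n (n + 1) / 2 - 1\<close>.

  For the immobilization, let a small motion \<open>x \<mapsto> R x + a\<close> move no contact point into the interior.
  Points in the relative interior of their facets then satisfy \<open>d i \<bullet> (R (p i) + a - p i) \<le> 0\<close>.
  Adding up, \<open>a\<close> drops out and the inner product of the moment matrix \<open>S\<close> of \<open>p\<close> with \<open>R - I\<close> is at
  most 0. But for symmetric \<open>S\<close> this inner product equals \<open>- 1/2\<close> times that of \<open>S\<close> with
  \<open>(R - I)\<^sup>T (R - I)\<close> (\<open>symmetric_inner_rotation\<close>), and this is positive if \<open>S\<close> is close to \<open>- (1/n) I\<close>
  and \<open>R \<noteq> I\<close>. So \<open>R = I\<close>, all \<open>d i \<bullet> a\<close> are at most 0 with sum 0, and \<open>a = 0\<close>.
\<close>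

section \<open>Lebesgue measure under linear maps\<close>

lemma nn_integral_lborel_translate:
  fixes h :: "'a::euclidean_space \<Rightarrow> ennreal"
  assumes [measurable]: "h \<in> borel_measurable borel"
  shows "(\<integral>\<^sup>+x. h (x + c) \<partial>lborel) = (\<integral>\<^sup>+x. h x \<partial>lborel)"
proof -
  have "(\<integral>\<^sup>+x. h x \<partial>lborel) = (\<integral>\<^sup>+x. h x \<partial>(distr lborel borel ((+) c)))"
    by (simp add: lborel_distr_plus)
  also have "\<dots> = (\<integral>\<^sup>+x. h (x + c) \<partial>lborel)"
    by (subst nn_integral_distr) (auto simp: add.commute)
  finally show ?thesis ..
qed

text \<open>
  The linear image of Lebesgue measure is a multiple of Lebesgue measure, because both are
  translation invariant. The identity is the usual uniqueness argument for invariant measures: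
  integrate the indicator of \<open>f x + y \<in> A, y \<in> B\<close> over all \<open>(x, y)\<close> in both orders. Taking for \<open>B\<close>
  the unit ball then determines the factor, with no determinant needed, for the two kinds of maps
  that occur below: isometries and linear involutions.
\<close>

lemma emeasure_linear_vimage_proportional:
  fixes f g :: "'a::euclidean_space \<Rightarrow> 'a"
  assumes f: "linear f" and fg: "\<And>x. f (g x) = x"
    and [measurable]: "A \<in> sets borel" "B \<in> sets borel"
  shows "emeasure lborel (f -` A) * emeasure lborel B
       = emeasure lborel A * emeasure lborel ((\<lambda>x. - f x) -` B)"
proof -
  have [measurable]: "f \<in> borel_measurable borel"
    using f by (simp add: borel_measurable_continuous_onI linear_continuous_on linear_conv_bounded_linear)
  have meas: "f -` A \<in> sets borel" "(\<lambda>x. - f x) -` B \<in> sets borel"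
    by (auto intro!: measurable_sets_borel[where M = borel])
  have shift: "(\<integral>\<^sup>+x. h (f x + y) \<partial>lborel) = (\<integral>\<^sup>+x. h (f x) \<partial>lborel)"
    if [measurable]: "h \<in> borel_measurable borel" for h :: "'a \<Rightarrow> ennreal" and y
    using nn_integral_lborel_translate[of "\<lambda>x. h (f x)" "g y"] by (simp add: linear_add[OF f] fg)
  have "emeasure lborel (f -` A) * emeasure lborel B
      = (\<integral>\<^sup>+y. indicator B y * (\<integral>\<^sup>+x. indicator A (f x) \<partial>lborel) \<partial>lborel)"
    using meas by (simp add: nn_integral_multc indicator_vimage[symmetric] mult.commute)
  also have "\<dots> = (\<integral>\<^sup>+y. (\<integral>\<^sup>+x. indicator B y * indicator A (f x + y) \<partial>lborel) \<partial>lborel)"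
    by (intro nn_integral_cong) (simp add: nn_integral_cmult shift[of "indicator A"])
  also have "\<dots> = (\<integral>\<^sup>+x. (\<integral>\<^sup>+y. indicator B y * indicator A (f x + y) \<partial>lborel) \<partial>lborel)"
    by (rule lborel_pair.Fubini') measurable
  also have "\<dots> = (\<integral>\<^sup>+x. (\<integral>\<^sup>+y. indicator B (y - f x) * indicator A y \<partial>lborel) \<partial>lborel)"
  proof (rule nn_integral_cong)
    fix x
    show "(\<integral>\<^sup>+y. indicator B y * indicator A (f x + y) \<partial>lborel)
        = (\<integral>\<^sup>+y. indicator B (y - f x) * indicator A y \<partial>lborel)"
      using nn_integral_lborel_translate[of "\<lambda>y. indicator B y * indicator A (f x + y)" "- f x"]
      by simp
  qed
  also have "\<dots> = (\<integral>\<^sup>+y. (\<integral>\<^sup>+x. indicator B (y - f x) * indicator A y \<partial>lborel) \<partial>lborel)"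
    by (rule lborel_pair.Fubini') measurable
  also have "\<dots> = (\<integral>\<^sup>+y. (\<integral>\<^sup>+x. indicator B (- f x) \<partial>lborel) * indicator A y \<partial>lborel)"
  proof (rule nn_integral_cong)
    fix y
    show "(\<integral>\<^sup>+x. indicator B (y - f x) * indicator A y \<partial>lborel)
        = (\<integral>\<^sup>+x. indicator B (- f x) \<partial>lborel) * indicator A y"
      using shift[of "\<lambda>z. indicator B (- z)" "- y"] by (simp add: nn_integral_multc)
  qed
  also have "\<dots> = emeasure lborel A * emeasure lborel ((\<lambda>x. - f x) -` B)"
  proof -
    have "indicator B (- f x) = (indicator ((\<lambda>x. - f x) -` B) x :: ennreal)" for x
      by (simp add: indicator_def)
    then show ?thesis using meas by (subst mult.commute) (simp add: nn_integral_multc)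
  qed
  finally show ?thesis .
qed

lemma emeasure_unit_ball_bounds:
  "0 < emeasure lborel (ball (0::'a::euclidean_space) 1)" "emeasure lborel (ball (0::'a) 1) < \<infinity>"
  by (auto simp: emeasure_ball unit_ball_vol_pos)

lemma emeasure_orthogonal_vimage:
  fixes f :: "'a::euclidean_space \<Rightarrow> 'a"
  assumes f: "orthogonal_transformation f" and A: "A \<in> sets borel"
  shows "emeasure lborel (f -` A) = emeasure lborel A"
proof -
  have lin: "linear f" and nrm: "\<And>x. norm (f x) = norm x"
    using f by (auto simp: orthogonal_transformation)
  have "\<And>x. f (inv f x) = x"
    using orthogonal_transformation_surj[OF f] by (simp add: surj_f_inv_f)
  from emeasure_linear_vimage_proportional[OF lin this A, of "ball 0 1"]
  have "emeasure lborel (f -` A) * emeasure lborel (ball (0::'a) 1)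
      = emeasure lborel A * emeasure lborel ((\<lambda>x. - f x) -` ball 0 1)" by simp
  moreover have "(\<lambda>x. - f x) -` ball 0 1 = ball (0::'a) 1"
    by (auto simp: nrm)
  ultimately show ?thesis
    using emeasure_unit_ball_bounds[where 'a='a]
    by (auto simp: mult.commute[of _ "emeasure lborel (ball 0 1)"] ennreal_mult_cancel_left)
qed

lemma emeasure_involution_vimage:
  fixes f :: "'a::euclidean_space \<Rightarrow> 'a"
  assumes f: "linear f" and ff: "\<And>x. f (f x) = x" and A: "A \<in> sets borel"
  shows "emeasure lborel (f -` A) = emeasure lborel A"
proof -
  let ?B = "ball (0::'a) 1"
  let ?b = "emeasure lborel ?B" and ?m = "emeasure lborel (f -` ?B)"
  have b: "?b \<noteq> 0" "?b \<noteq> \<infinity>" using emeasure_unit_ball_bounds[where 'a='a] by auto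
  have [measurable]: "f \<in> borel_measurable borel"
    using f by (simp add: borel_measurable_continuous_onI linear_continuous_on linear_conv_bounded_linear)
  have fB: "f -` ?B \<in> sets borel" by (intro measurable_sets_borel[of f borel]) auto
  have "(\<lambda>x. - f x) -` ?B = f -` ?B" by auto
  then have scale: "emeasure lborel (f -` C) * ?b = emeasure lborel C * ?m" if "C \<in> sets borel" for C
    using emeasure_linear_vimage_proportional[OF f ff that, of ?B] by simp
  have "f -` f -` ?B = ?B" using ff by auto
  \<comment> \<open>the proportionality factor \<open>?m / ?b\<close> of \<open>f\<close> squares to that of the identity\<close>
  then have "?b * ?b = ?m * ?m" using scale[OF fB] by simp
  then have "?m = ?b"
    using b by (cases ?m; cases ?b) (auto simp: ennreal_power power_eq_iff_eq_base simp flip: power2_eq_square)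
  then show ?thesis using scale[OF A] b
    by (simp add: mult.commute[of _ ?b] ennreal_mult_cancel_left)
qed

section \<open>Lower-dimensional volume and prisms\<close>

text \<open>
  \<open>relative_volume\<close> uses a product measure indexed by an orthonormal set of vectors; this allows
  such an index set to be exchanged for the standard basis.
\<close>

lemma distr_PiM_lborel_reindex:
  assumes bij: "bij_betw f K I" and fin: "finite K"
  shows "distr (PiM I (\<lambda>_. lborel :: real measure)) (PiM K (\<lambda>_. lborel)) (\<lambda>\<omega>. \<lambda>k\<in>K. \<omega> (f k))
       = PiM K (\<lambda>_. lborel)" (is "distr ?P ?Q ?r = ?Q")
proof -
  interpret product_sigma_finite "\<lambda>_. lborel :: real measure" ..
  have finI: "finite I" using bij fin by (simp add: bij_betw_finite)
  have fI: "k \<in> K \<Longrightarrow> f k \<in> I" for k using bij by (auto simp: bij_betw_def)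
  have [measurable]: "?r \<in> measurable ?P ?Q"
    by (intro measurable_restrict measurable_component_singleton fI)
  show ?thesis
  proof (rule PiM_eqI[OF fin])
    fix A assume A: "\<And>k. k \<in> K \<Longrightarrow> A k \<in> sets (lborel :: real measure)"
    let ?g = "the_inv_into K f"
    have g: "i \<in> I \<Longrightarrow> ?g i \<in> K" for i
      using bij by (metis bij_betw_def the_inv_into_into order_refl)
    have gf: "k \<in> K \<Longrightarrow> ?g (f k) = k" for k
      using bij by (simp add: bij_betw_def the_inv_into_f_f)
    have "?r -` Pi\<^sub>E K A \<inter> space ?P = Pi\<^sub>E I (\<lambda>i. A (?g i))"
    proof (intro equalityI subsetI)
      fix x assume x: "x \<in> ?r -` Pi\<^sub>E K A \<inter> space ?P"
      have "x i \<in> A (?g i)" if i: "i \<in> I" for i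
      proof -
        obtain k where "k \<in> K" "i = f k" using bij i by (auto simp: bij_betw_def)
        then show ?thesis using x gf by (auto simp: PiE_iff)
      qed
      then show "x \<in> Pi\<^sub>E I (\<lambda>i. A (?g i))" using x by (auto simp: space_PiM PiE_iff)
    next
      fix x assume "x \<in> Pi\<^sub>E I (\<lambda>i. A (?g i))"
      then show "x \<in> ?r -` Pi\<^sub>E K A \<inter> space ?P"
        using fI gf by (fastforce simp: space_PiM PiE_iff)
    qed
    then have "emeasure (distr ?P ?Q ?r) (Pi\<^sub>E K A) = emeasure ?P (Pi\<^sub>E I (\<lambda>i. A (?g i)))"
      using A fin by (subst emeasure_distr) auto
    also have "\<dots> = (\<Prod>i\<in>I. emeasure lborel (A (?g i)))"
      using A g by (intro emeasure_PiM finI) auto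
    also have "\<dots> = (\<Prod>k\<in>K. emeasure lborel (A k))"
      using gf by (subst prod.reindex_bij_betw[OF bij, symmetric]) auto
    finally show "emeasure (distr ?P ?Q ?r) (Pi\<^sub>E K A) = (\<Prod>k\<in>K. emeasure lborel (A k))" .
  qed simp
qed

lemma emeasure_orthonormal_coordinates:
  fixes E :: "'a::euclidean_space set"
  assumes orth: "pairwise orthogonal E" and unit: "\<And>e. e \<in> E \<Longrightarrow> norm e = 1"
    and card: "card E = DIM('a)" and A: "A \<in> sets borel"
  shows "emeasure lborel A
       = emeasure (PiM E (\<lambda>_. lborel :: real measure))
           {c \<in> space (PiM E (\<lambda>_. lborel)). (\<Sum>e\<in>E. c e *\<^sub>R e) \<in> A}"
proof -
  let ?P = "\<lambda>I :: 'a set. PiM I (\<lambda>_. lborel :: real measure)"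
  have fin: "finite E" using card by (metis DIM_positive card.infinite less_irrefl)
  obtain f where bij: "bij_betw f (Basis :: 'a set) E"
    using card fin by (metis finite_Basis finite_same_card_bij)
  have fE: "b \<in> Basis \<Longrightarrow> f b \<in> E" for b using bij by (auto simp: bij_betw_def)
  define L where "L x = (\<Sum>b\<in>Basis. (x \<bullet> b) *\<^sub>R f b)" for x
  have "linear L"
    unfolding L_def
    by (intro linearI) (auto simp: inner_add_left scaleR_left_distrib sum.distrib scaleR_sum_right)
  have ff: "f b \<bullet> f b' = (if b = b' then 1 else 0)" if "b \<in> Basis" "b' \<in> Basis" for b b'
  proof (cases "b = b'")
    case True
    then show ?thesis using unit[OF fE] that by (simp add: norm_eq_1)
  next
    case False
    then have "f b \<noteq> f b'" using bij that by (auto simp: bij_betw_def inj_on_def)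
    then show ?thesis using orth fE that False by (auto simp: pairwise_def orthogonal_def)
  qed
  have "L x \<bullet> L y = x \<bullet> y" for x y
    unfolding L_def
    by (subst euclidean_inner[of x y])
       (simp add: inner_sum_left inner_sum_right ff if_distrib sum.delta mult.commute cong: if_cong)
  with \<open>linear L\<close> have L: "orthogonal_transformation L"
    by (simp add: orthogonal_transformation_def)
  have [measurable]: "L \<in> borel_measurable borel"
    using \<open>linear L\<close> by (simp add: borel_measurable_continuous_onI linear_continuous_on linear_conv_bounded_linear)
  have LA: "L -` A \<in> sets borel" by (rule measurable_sets_borel[OF _ A]) measurable
  let ?r = "\<lambda>\<omega>. \<lambda>b\<in>Basis. \<omega> (f b)" 
  have [measurable]: "?r \<in> measurable (?P E) (?P Basis)"
    by (intro measurable_restrict measurable_component_singleton fE)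
  have "emeasure lborel A = emeasure lborel (L -` A)"
    by (rule emeasure_orthogonal_vimage[OF L A, symmetric])
  also have "\<dots> = emeasure (?P Basis) {c \<in> space (?P Basis). (\<Sum>b\<in>Basis. c b *\<^sub>R b) \<in> L -` A}"
    using LA by (subst lborel_eq, subst emeasure_distr) (auto intro!: arg_cong2[where f = emeasure])
  also have "\<dots> = emeasure (?P Basis) {c \<in> space (?P Basis). (\<Sum>b\<in>Basis. c b *\<^sub>R f b) \<in> A}"
    by (simp add: L_def inner_sum_left_Basis)
  also have "\<dots> = emeasure (distr (?P E) (?P Basis) ?r) {c \<in> space (?P Basis). (\<Sum>b\<in>Basis. c b *\<^sub>R f b) \<in> A}"
    by (simp add: distr_PiM_lborel_reindex[OF bij])
  also have "\<dots> = emeasure (?P E) (?r -` {c \<in> space (?P Basis). (\<Sum>b\<in>Basis. c b *\<^sub>R f b) \<in> A} \<inter> space (?P E))"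
    by (rule emeasure_distr) (use A in measurable)
  also have "?r -` {c \<in> space (?P Basis). (\<Sum>b\<in>Basis. c b *\<^sub>R f b) \<in> A} \<inter> space (?P E)
     = {c \<in> space (?P E). (\<Sum>e\<in>E. c e *\<^sub>R e) \<in> A}"
    by (auto simp: space_PiM sum.reindex_bij_betw[OF bij, symmetric])
  finally show ?thesis .
qed

definition prism :: "'a::real_vector set \<Rightarrow> 'a \<Rightarrow> 'a set" where
  "prism F w = (\<lambda>(x, t). x + t *\<^sub>R w) ` (F \<times> {0..1})"

lemma compact_prism:
  fixes F :: "'a::real_normed_vector set"
  shows "compact F \<Longrightarrow> compact (prism F w)"
  unfolding prism_def case_prod_unfold
  by (intro compact_continuous_image compact_Times continuous_intros) auto

text \<open>
  The frame in the definition of \<open>relative_volume\<close> is an unspecified choice, so the only thing known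
  about it is that it is a frame. The later results hold for every frame.
\<close>

lemma relative_volume_frame:
  fixes F :: "'a::euclidean_space set"
  assumes "F \<noteq> {}"
  obtains a B where "cartesian_frame F a B" and
    "relative_volume F = measure (PiM B (\<lambda>_. lborel :: real measure))
       {c \<in> space (PiM B (\<lambda>_. lborel)). a + (\<Sum>b\<in>B. c b *\<^sub>R b) \<in> F}"
proof -
  obtain a where a: "a \<in> F" using assms by auto
  let ?V = "(\<lambda>x. - a + x) ` (affine hull F)"
  have "subspace ?V"
    using a by (metis affine_affine_hull affine_diffs_subspace hull_inc)
  then obtain B where B: "pairwise orthogonal B" "\<And>x. x \<in> B \<Longrightarrow> norm x = 1" "span B = ?V"
    using orthonormal_basis_subspace by metis
  have "affine hull F = (\<lambda>x. a + x) ` ?V" by (simp add: image_image)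
  then have "cartesian_frame F a B" using B by (simp add: cartesian_frame_def)
  then have "\<exists>ab. (case ab of (a, B) \<Rightarrow> cartesian_frame F a B)" by auto
  from someI_ex[OF this] obtain a B where
    "(SOME (a, B). cartesian_frame F a B) = (a, B)" "cartesian_frame F a B"
    by (auto split: prod.splits)
  moreover from this(1) have "relative_volume F = measure (PiM B (\<lambda>_. lborel :: real measure))
       {c \<in> space (PiM B (\<lambda>_. lborel)). a + (\<Sum>b\<in>B. c b *\<^sub>R b) \<in> F}"
    by (simp only: relative_volume_def Let_def prod.case)
  ultimately show thesis using that by blast
qed

text \<open>
  In orthonormal coordinates of which the last one is along \<open>u\<close>, a right prism over \<open>F\<close> is a
  product of an interval and the coordinate image of \<open>F\<close>, and Fubini gives base times height.
\<close>

lemma measure_orthogonal_prism: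
  fixes F :: "'a::euclidean_space set"
  assumes F: "compact F" "F \<noteq> {}" and u: "norm u = 1"
    and perp: "\<And>x y. x \<in> F \<Longrightarrow> y \<in> F \<Longrightarrow> u \<bullet> (x - y) = 0"
    and dim: "aff_dim F = int DIM('a) - 1"
  shows "measure lborel (prism F (s *\<^sub>R u)) = \<bar>s\<bar> * relative_volume F"
proof -
  interpret product_sigma_finite "\<lambda>_. lborel :: real measure" ..
  obtain a B where frame: "cartesian_frame F a B" and
    vol: "relative_volume F = measure (PiM B (\<lambda>_. lborel :: real measure))
       {c \<in> space (PiM B (\<lambda>_. lborel)). a + (\<Sum>b\<in>B. c b *\<^sub>R b) \<in> F}"
    by (rule relative_volume_frame[OF F(2)])
  let ?P = "\<lambda>I :: 'a set. PiM I (\<lambda>_. lborel :: real measure)"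
  let ?C = "{c \<in> space (?P B). a + (\<Sum>b\<in>B. c b *\<^sub>R b) \<in> F}"
  have orth: "pairwise orthogonal B" and unit: "\<And>b. b \<in> B \<Longrightarrow> norm b = 1"
    and hull: "affine hull F = (\<lambda>x. a + x) ` span B"
    using frame by (auto simp: cartesian_frame_def)
  have "independent B"
    using orth unit[of 0] by (intro pairwise_orthogonal_independent) auto
  have "int (card B) = aff_dim (affine hull F)"
    unfolding hull aff_dim_translation_eq aff_dim_subspace[OF subspace_span]
    using \<open>independent B\<close> by (simp add: dim_eq_card_independent)
  then have card: "card B + 1 = DIM('a)" using dim unfolding aff_dim_affine_hull by linarith
  have finB: "finite B" by (rule independent_imp_finite) fact
  have uspan: "u \<bullet> b = 0" if b: "b \<in> span B" for b
  proof -
    obtain z where z: "z \<in> F" using F(2) by auto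
    have "affine {x. u \<bullet> x = u \<bullet> z}" by (rule affine_hyperplane)
    moreover have "F \<subseteq> {x. u \<bullet> x = u \<bullet> z}" using perp[OF _ z] by (simp add: inner_diff_right subset_iff)
    ultimately have "affine hull F \<subseteq> {x. u \<bullet> x = u \<bullet> z}" by (simp add: hull_minimal)
    moreover have "a + b \<in> affine hull F" "a + 0 \<in> affine hull F"
      unfolding hull using b by (auto intro: span_zero)
    ultimately have "u \<bullet> (a + b) = u \<bullet> z" "u \<bullet> (a + 0) = u \<bullet> z" by auto
    then show ?thesis by (simp add: inner_add_right)
  qed
  then have ub: "\<And>b. b \<in> B \<Longrightarrow> u \<bullet> b = 0" by (simp add: span_base)
  have uB: "u \<notin> B" using ub[of u] u by auto
  let ?E = "insert u B"
  let ?S = "prism F (s *\<^sub>R u)"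
  let ?I = "(\<lambda>t. t * s) ` {0..1::real}"
  have S: "compact ?S" by (simp add: compact_prism F)
  have coord: "a + (y *\<^sub>R u + (\<Sum>b\<in>B. c b *\<^sub>R b)) \<in> ?S \<longleftrightarrow> y \<in> ?I \<and> a + (\<Sum>b\<in>B. c b *\<^sub>R b) \<in> F" for y c
  proof
    assume "a + (y *\<^sub>R u + (\<Sum>b\<in>B. c b *\<^sub>R b)) \<in> ?S"
    then obtain x t where x: "x \<in> F" "t \<in> {0..1}"
      and eq: "a + (y *\<^sub>R u + (\<Sum>b\<in>B. c b *\<^sub>R b)) = x + t *\<^sub>R s *\<^sub>R u"
      by (auto simp: prism_def)
    obtain w where w: "w \<in> span B" "x = a + w" using x hull by (metis hull_inc imageE)
    have sumB: "(\<Sum>b\<in>B. c b *\<^sub>R b) \<in> span B" by (intro span_sum span_mul span_base)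
    have "u \<bullet> (y *\<^sub>R u + (\<Sum>b\<in>B. c b *\<^sub>R b)) = u \<bullet> (w + t *\<^sub>R s *\<^sub>R u)"
      using eq w by (simp add: add.assoc)
    then have "y = t * s"
      using u uspan[OF sumB] uspan[OF w(1)] by (auto simp: inner_add_right norm_eq_1)
    then show "y \<in> ?I \<and> a + (\<Sum>b\<in>B. c b *\<^sub>R b) \<in> F" using x eq by auto
  next
    assume "y \<in> ?I \<and> a + (\<Sum>b\<in>B. c b *\<^sub>R b) \<in> F"
    then obtain t where "t \<in> {0..1}" "y = t * s" "a + (\<Sum>b\<in>B. c b *\<^sub>R b) \<in> F" by auto
    then show "a + (y *\<^sub>R u + (\<Sum>b\<in>B. c b *\<^sub>R b)) \<in> ?S"
      unfolding prism_def by (intro image_eqI[of _ _ "(a + (\<Sum>b\<in>B. c b *\<^sub>R b), t)"]) auto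
  qed
  have I: "emeasure lborel ?I = ennreal \<bar>s\<bar>" "?I \<in> sets borel"
  proof -
    have "?I = (if 0 \<le> s then {0..s} else {s..0})"
      by (auto simp: image_mult_atLeastAtMost_if')
    then show "emeasure lborel ?I = ennreal \<bar>s\<bar>" "?I \<in> sets borel" by auto
  qed
  have [measurable]: "F \<in> sets borel" "?S \<in> sets borel"
    using F S by (auto intro: borel_compact)
  have C: "?C \<in> sets (?P B)" by measurable
  let ?T = "(\<lambda>x. a + x) -` ?S"
  have T: "?T \<in> sets borel" by (rule measurable_sets_borel[of _ borel]) auto
  have "emeasure lborel ?S = emeasure lborel ?T"
    by (subst lborel_distr_plus[of a, symmetric], subst emeasure_distr) auto
  also have "\<dots> = emeasure (?P ?E) {c \<in> space (?P ?E). (\<Sum>e\<in>?E. c e *\<^sub>R e) \<in> ?T}"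
  proof (rule emeasure_orthonormal_coordinates[OF _ _ _ T])
    show "pairwise orthogonal ?E"
      using orth ub by (auto simp: pairwise_insert orthogonal_def inner_commute)
    show "card ?E = DIM('a)" using card uB finB by simp
  qed (use u unit in auto)
  also have "\<dots> = (\<integral>\<^sup>+c. indicator {c \<in> space (?P ?E). (\<Sum>e\<in>?E. c e *\<^sub>R e) \<in> ?T} c \<partial>?P ?E)"
    by (rule nn_integral_indicator[symmetric]) (use T in measurable)
  also have "\<dots> = (\<integral>\<^sup>+c. (\<integral>\<^sup>+y. indicator {c \<in> space (?P ?E). (\<Sum>e\<in>?E. c e *\<^sub>R e) \<in> ?T} (c(u := y)) \<partial>lborel) \<partial>?P B)"
    by (rule product_nn_integral_insert[OF finB uB]) (use T in measurable)
  also have "\<dots> = (\<integral>\<^sup>+c. (\<integral>\<^sup>+y. indicator ?I y * indicator ?C c \<partial>lborel) \<partial>?P B)"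
  proof (intro nn_integral_cong)
    fix c y assume c: "c \<in> space (?P B)"
    have "(\<Sum>b\<in>B. (c(u := y)) b *\<^sub>R b) = (\<Sum>b\<in>B. c b *\<^sub>R b)"
      using uB by (intro sum.cong) auto
    then have "(\<Sum>e\<in>?E. (c(u := y)) e *\<^sub>R e) = y *\<^sub>R u + (\<Sum>b\<in>B. c b *\<^sub>R b)"
      using uB finB by simp
    moreover have "c(u := y) \<in> space (?P ?E)"
      using c by (auto simp: space_PiM PiE_iff extensional_def)
    ultimately show "indicator {c \<in> space (?P ?E). (\<Sum>e\<in>?E. c e *\<^sub>R e) \<in> ?T} (c(u := y))
        = (indicator ?I y * indicator ?C c :: ennreal)"
      using c coord[of y c] by (auto simp: indicator_def)
  qed
  also have "\<dots> = ennreal \<bar>s\<bar> * emeasure (?P B) ?C"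
    using I C by (simp add: nn_integral_multc nn_integral_cmult)
  finally show ?thesis
    unfolding vol by (simp add: measure_def enn2real_mult)
qed

text \<open>
  For \<open>a \<bullet> b = 2\<close> the map \<open>x \<mapsto> x - (b \<bullet> x) a\<close> is an involution (a reflection along \<open>a\<close>, not
  necessarily orthogonal, in the hyperplane orthogonal to \<open>b\<close>), hence preserves volume. Maps of this
  form serve both to shear prisms and to exchange two vertices of a simplex.
\<close>

lemma measure_oblique_reflection_image:
  fixes a b :: "'a::euclidean_space"
  assumes ab: "a \<bullet> b = 2" and S: "compact S"
  shows "measure lborel ((\<lambda>x. p + (x - (b \<bullet> x) *\<^sub>R a)) ` S) = measure lborel S"
proof -
  define f where "f x = x - (b \<bullet> x) *\<^sub>R a" for x
  have lin: "linear f"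
    unfolding f_def by (intro linearI) (auto simp: algebra_simps inner_simps)
  have ff: "f (f x) = x" for x
    using ab by (simp add: f_def inner_simps inner_commute[of b a] algebra_simps flip: scaleR_add_left)
  have img: "f ` S = f -` S" using ff by (auto simp: image_iff) (metis ff)
  have SB: "S \<in> sets borel" using S by (rule borel_compact)
  have cf: "compact (f ` S)"
    using S lin by (intro compact_continuous_image linear_continuous_on) (auto simp: linear_conv_bounded_linear)
  have "emeasure lborel ((\<lambda>x. p + f x) ` S) = emeasure lborel ((+) p -` ((+) p ` f ` S))"
    using borel_compact[OF compact_translation[OF cf]]
    by (subst lborel_distr_plus[of p, symmetric], subst emeasure_distr) (auto simp: image_image)
  also have "(+) p -` ((+) p ` f ` S) = f -` S" by (auto simp flip: img)
  also have "emeasure lborel (f -` S) = emeasure lborel S"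
    by (rule emeasure_involution_vimage[OF lin ff SB])
  finally show ?thesis by (simp add: measure_def f_def)
qed

text \<open>
  Instead of a shear, an oblique reflection fixing the hyperplane of \<open>F\<close> takes a right prism over
  \<open>F\<close>, lying on the other side of that hyperplane, to the given oblique one.
\<close>

lemma measure_prism:
  fixes F :: "'a::euclidean_space set"
  assumes F: "compact F" "F \<noteq> {}" and u: "norm u = 1"
    and perp: "\<And>x y. x \<in> F \<Longrightarrow> y \<in> F \<Longrightarrow> u \<bullet> (x - y) = 0"
    and dim: "aff_dim F = int DIM('a) - 1" and uw: "u \<bullet> w \<noteq> 0"
  shows "measure lborel (prism F w) = \<bar>u \<bullet> w\<bar> * relative_volume F"
proof -
  let ?s = "u \<bullet> w"
  \<comment> \<open>the reflection along \<open>a\<close> takes \<open>- ?s u\<close> to \<open>w\<close>\<close>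
  define a where "a = u + (1 / ?s) *\<^sub>R w"
  have au: "a \<bullet> u = 2" using u uw by (simp add: a_def inner_simps norm_eq_1 inner_commute)
  obtain z where z: "z \<in> F" using F by auto
  let ?f = "\<lambda>x. (u \<bullet> z) *\<^sub>R a + (x - (u \<bullet> x) *\<^sub>R a)"
  have *: "?f (x + t *\<^sub>R (- ?s) *\<^sub>R u) = x + t *\<^sub>R w" if "x \<in> F" for x t
  proof -
    have "u \<bullet> x = u \<bullet> z" using perp[OF that z] by (simp add: inner_diff_right)
    then have "?f (x + t *\<^sub>R (- ?s) *\<^sub>R u) = x - (t * ?s) *\<^sub>R u + (t * ?s) *\<^sub>R a"
      using u by (simp add: inner_simps norm_eq_1 algebra_simps)
    also have "\<dots> = x + t *\<^sub>R w" using uw by (simp add: a_def algebra_simps)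
    finally show ?thesis .
  qed
  have "prism F w = ?f ` prism F ((- ?s) *\<^sub>R u)"
    unfolding prism_def image_image
  proof (rule image_cong)
    fix y :: "'a \<times> real" assume "y \<in> F \<times> {0..1}"
    then show "(case y of (x, t) \<Rightarrow> x + t *\<^sub>R w) = ?f (case y of (x, t) \<Rightarrow> x + t *\<^sub>R (- ?s) *\<^sub>R u)"
      using *[of "fst y" "snd y"] by (simp only: mem_Times_iff case_prod_unfold)
  qed simp
  then have "measure lborel (prism F w) = measure lborel (prism F ((- ?s) *\<^sub>R u))"
    using measure_oblique_reflection_image[OF au compact_prism[OF F(1)]] by simp
  also have "\<dots> = \<bar>- ?s\<bar> * relative_volume F"
    by (rule measure_orthogonal_prism[OF F u perp dim])
  finally show ?thesis by simp
qed

section \<open>Outward normals as gradients of barycentric coordinates\<close>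

text \<open>
  \<open>d i\<close> is the gradient of the barycentric coordinate that is 1 at \<open>v i\<close> and 0 at the other vertices.
  Fixing its values on differences of vertices treats all vertices alike.
\<close>

definition barycentric_gradients :: "('n option \<Rightarrow> real ^ 'n) \<Rightarrow> ('n option \<Rightarrow> real ^ 'n) \<Rightarrow> bool" where
  "barycentric_gradients v d \<longleftrightarrow>
     (\<forall>i j l. d i \<bullet> (v j - v l) = of_bool (i = j) - of_bool (i = l))"

lemma edges_basis:
  fixes v :: "'n::finite option \<Rightarrow> real ^ 'n"
  assumes "nondegenerate_simplex v"
  shows "inj (\<lambda>j. v (Some j) - v None)" "independent (range (\<lambda>j. v (Some j) - v None))"
    "span (range (\<lambda>j. v (Some j) - v None)) = UNIV"
proof -
  have inj: "inj v" and ind: "\<not> affine_dependent (range v)"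
    using assms by (auto simp: nondegenerate_simplex_def)
  show I: "inj (\<lambda>j. v (Some j) - v None)"
    by (rule injI) (use inj in \<open>auto dest: injD\<close>)
  have "range v - {v None} = range (\<lambda>j. v (Some j))"
    using inj by (auto simp: inj_def) (metis not_None_eq rangeI)
  then have "(\<lambda>x. - v None + x) ` (range v - {v None}) = range (\<lambda>j. v (Some j) - v None)"
    by (auto simp: image_image)
  then show IN: "independent (range (\<lambda>j. v (Some j) - v None))"
    using ind affine_dependent_iff_dependent2[of "v None" "range v"] by auto
  have "card (range (\<lambda>j. v (Some j) - v None)) = DIM(real ^ 'n)"
    using card_image[OF I] by simp
  then show "span (range (\<lambda>j. v (Some j) - v None)) = UNIV"
    using IN card_eq_dim[of "range (\<lambda>j. v (Some j) - v None)" UNIV] by (auto simp: dim_UNIV)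
qed

lemma orthogonal_to_edges_imp_zero:
  fixes v :: "'n::finite option \<Rightarrow> real ^ 'n"
  assumes "nondegenerate_simplex v" "\<And>j l. y \<bullet> (v j - v l) = 0"
  shows "y = 0"
proof -
  have "y \<in> span (range (\<lambda>j. v (Some j) - v None))" by (simp add: edges_basis(3)[OF assms(1)])
  then have "orthogonal y y"
    by (rule orthogonal_to_span) (use assms(2) in \<open>auto simp: orthogonal_def\<close>)
  then show ?thesis by (simp add: orthogonal_self)
qed

lemma barycentric_gradients_exist:
  fixes v :: "'n::finite option \<Rightarrow> real ^ 'n"
  assumes "nondegenerate_simplex v"
  obtains d where "barycentric_gradients v d"
proof -
  let ?e = "\<lambda>j. v (Some j) - v None"
  note E = edges_basis[OF assms]
  have "\<exists>y. \<forall>j. y \<bullet> (v j - v None) = of_bool (i = j) - of_bool (i = None)" for i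
  proof -
    have "\<exists>g. linear g \<and> (\<forall>x\<in>range ?e. g x = of_bool (i = Some (inv ?e x)) - (of_bool (i = None) :: real))"
      by (rule linear_independent_extend[OF E(2)])
    then obtain g where g: "linear g"
      "\<And>x. x \<in> range ?e \<Longrightarrow> g x = of_bool (i = Some (inv ?e x)) - (of_bool (i = None) :: real)"
      by blast
    have "adjoint g 1 \<bullet> x = g x" for x
      using adjoint_works[OF g(1), of x 1] by (simp add: inner_commute)
    moreover have "g (?e j) = of_bool (i = Some j) - of_bool (i = None)" for j
      using g(2)[of "?e j"] inv_f_f[OF E(1)] by simp
    ultimately have "adjoint g 1 \<bullet> (v j - v None) = of_bool (i = j) - of_bool (i = None)" for j
      by (cases j) auto
    then show ?thesis by blast
  qed
  then obtain d where d: "\<And>i j. d i \<bullet> (v j - v None) = of_bool (i = j) - of_bool (i = None)"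
    by metis
  have "d i \<bullet> (v j - v l) = of_bool (i = j) - of_bool (i = l)" for i j l
    using d[of i j] d[of i l] by (simp add: inner_diff_right)
  then show thesis using that by (auto simp: barycentric_gradients_def)
qed

lemma prism_image:
  assumes "\<And>x t. f (x + t *\<^sub>R a) = f x + t *\<^sub>R b"
  shows "f ` prism F a = prism (f ` F) b"
proof (intro equalityI subsetI)
  fix y assume "y \<in> f ` prism F a"
  then obtain x t where "x \<in> F" "t \<in> {0..1}" "y = f x + t *\<^sub>R b"
    using assms by (auto simp: prism_def)
  then show "y \<in> prism (f ` F) b"
    unfolding prism_def by (intro image_eqI[of _ _ "(f x, t)"]) auto
next
  fix y assume "y \<in> prism (f ` F) b"
  then obtain x t where "x \<in> F" "t \<in> {0..1}" "y = f (x + t *\<^sub>R a)"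
    using assms by (auto simp: prism_def)
  then show "y \<in> f ` prism F a"
    unfolding prism_def by (intro image_eqI image_eqI[of _ _ "(x, t)"]) auto
qed

lemma facet_geometry:
  fixes v :: "'n::finite option \<Rightarrow> real ^ 'n"
  assumes nd: "nondegenerate_simplex v" and d: "barycentric_gradients v d"
  shows "compact (facet v i)" "facet v i \<noteq> {}"
    "x \<in> facet v i \<Longrightarrow> y \<in> facet v i \<Longrightarrow> d i \<bullet> (x - y) = 0"
    "aff_dim (facet v i) = int DIM(real ^ 'n) - 1"
proof -
  have dd: "d i \<bullet> (v j - v l) = of_bool (i = j) - of_bool (i = l)" for i j l
    using d by (simp add: barycentric_gradients_def)
  show "compact (facet v i)"
    unfolding facet_def by (intro compact_convex_hull finite_imp_compact) auto
  have ne: "UNIV - {i} \<noteq> {}" by (cases i) auto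
  then show "facet v i \<noteq> {}" by (auto simp: facet_def)
  obtain m where m: "m \<noteq> i" using ne by auto
  have sub: "facet v i \<subseteq> {x. d i \<bullet> x = d i \<bullet> v m}"
    unfolding facet_def
  proof (rule hull_minimal)
    have "d i \<bullet> v j = d i \<bullet> v m" if "j \<noteq> i" for j
      using dd[of i j m] m[symmetric] that[symmetric] by (simp add: inner_diff_right)
    then show "v ` (UNIV - {i}) \<subseteq> {x. d i \<bullet> x = d i \<bullet> v m}" by auto
  qed (rule convex_hyperplane)
  show "d i \<bullet> (x - y) = 0" if "x \<in> facet v i" "y \<in> facet v i"
    using subsetD[OF sub that(1)] subsetD[OF sub that(2)] by (simp add: inner_diff_right)
  have inj: "inj v" and ind: "\<not> affine_dependent (range v)"
    using nd by (auto simp: nondegenerate_simplex_def)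
  have "\<not> affine_dependent (v ` (UNIV - {i}))"
    using ind by (metis affine_independent_subset image_mono subset_UNIV)
  then have "aff_dim (v ` (UNIV - {i})) = int (card (v ` (UNIV - {i}))) - 1"
    using aff_dim_affine_independent by fastforce
  also have "card (v ` (UNIV - {i})) = CARD('n)"
    using inj by (subst card_image) (auto intro: inj_on_subset simp: card_Diff_singleton)
  finally show "aff_dim (facet v i) = int DIM(real ^ 'n) - 1"
    by (simp add: facet_def aff_dim_convex_hull)
qed

text \<open>
  The affine map exchanging the vertices \<open>v i\<close> and \<open>v j\<close> and fixing all others is an oblique
  reflection. It takes facet \<open>i\<close> to facet \<open>j\<close>, and the prism over the one along the common edge to the
  prism over the other.
\<close>

lemma facet_prism_swap:
  fixes v :: "'n::finite option \<Rightarrow> real ^ 'n"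
  assumes d: "barycentric_gradients v d" and ij: "i \<noteq> j"
  shows "measure lborel (prism (facet v i) (v i - v j)) = measure lborel (prism (facet v j) (v j - v i))"
proof -
  have dd: "d i \<bullet> (v j - v l) = of_bool (i = j) - of_bool (i = l)" for i j l
    using d by (simp add: barycentric_gradients_def)
  \<comment> \<open>\<open>?b\<close> takes the value 2 on \<open>?a\<close> and 0 on edges avoiding \<open>v i\<close> and \<open>v j\<close>\<close>
  let ?a = "v i - v j" and ?b = "d i - d j"
  have "?b \<bullet> ?a = 2"
    using ij dd[of i i j] dd[of j i j] by (simp add: inner_diff_left)
  then have ab: "?a \<bullet> ?b = 2" by (simp only: inner_commute)
  have compF: "compact (facet v i)"
    unfolding facet_def by (intro compact_convex_hull finite_imp_compact) auto
  define L where "L x = x - (?b \<bullet> x) *\<^sub>R ?a" for x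
  let ?S = "\<lambda>x. (v j - L (v i)) + L x"
  have lin: "linear L"
    unfolding L_def by (intro linearI) (auto simp: algebra_simps inner_simps)
  have S: "?S (v m) = (if m = i then v j else if m = j then v i else v m)" for m
  proof -
    have "?S (v m) = v j + L (v m - v i)" by (simp add: linear_diff[OF lin])
    also have "?b \<bullet> (v m - v i) = of_bool (m = i) - 1 - of_bool (m = j)"
      using ij dd[of i m i] dd[of j m i] by (auto simp: inner_diff_left)
    then have "v j + L (v m - v i) = v j + (v m - v i) - (of_bool (m = i) - 1 - of_bool (m = j)) *\<^sub>R ?a"
      by (simp add: L_def)
    also have "\<dots> = (if m = i then v j else if m = j then v i else v m)"
      using ij by (auto simp: algebra_simps scaleR_2)
    finally show ?thesis .
  qed
  have "v ` (UNIV - {j}) = ?S ` v ` (UNIV - {i})"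
  proof -
    have "v ` (UNIV - {j}) = (\<lambda>m. if m = i then v j else if m = j then v i else v m) ` (UNIV - {i})"
      using ij by (auto simp: image_iff)
    then show ?thesis by (simp only: image_image S)
  qed
  then have "facet v j = convex hull ((+) (v j - L (v i)) ` L ` v ` (UNIV - {i}))"
    by (simp only: facet_def image_image)
  also have "\<dots> = (+) (v j - L (v i)) ` L ` facet v i"
    by (simp only: facet_def convex_hull_translation convex_hull_linear_image[OF lin])
  finally have F: "facet v j = ?S ` facet v i" by (simp only: image_image)
  have La: "L ?a = v j - v i"
    using \<open>?b \<bullet> ?a = 2\<close> by (simp add: L_def scaleR_2)
  have "?S ` prism (facet v i) ?a = prism (?S ` facet v i) (v j - v i)"
    by (rule prism_image) (simp only: linear_add[OF lin] linear_scale[OF lin] La add.assoc)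
  then have "prism (facet v j) (v j - v i) = ?S ` prism (facet v i) ?a"
    by (simp only: F)
  then show ?thesis
    using measure_oblique_reflection_image[OF ab compact_prism[OF compF], of "v j - L (v i)" ?a]
    by (simp only: L_def)
qed

text \<open>
  The prism contains the simplex, which has interior points.
\<close>

lemma measure_facet_prism_pos:
  fixes v :: "'n::finite option \<Rightarrow> real ^ 'n"
  assumes nd: "nondegenerate_simplex v" and ij: "i \<noteq> j"
  shows "0 < measure lborel (prism (facet v i) (v i - v j))"
proof -
  let ?P = "prism (facet v i) (v i - v j)"
  have F: "compact (facet v i)" "convex (facet v i)"
    unfolding facet_def by (intro compact_convex_hull finite_imp_compact) auto
  have "convex ?P"
  proof -
    have "?P = (\<lambda>z. fst z + snd z *\<^sub>R (v i - v j)) ` (facet v i \<times> {0..1})"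
      by (simp add: prism_def case_prod_unfold)
    moreover have "linear (\<lambda>z :: (real ^ 'n) \<times> real. fst z + snd z *\<^sub>R (v i - v j))"
      by (intro linearI) (auto simp: algebra_simps)
    ultimately show ?thesis
      using F by (simp only: convex_linear_image convex_Times convex_real_interval)
  qed
  have vF: "v m \<in> facet v i" if "m \<noteq> i" for m
    using that by (auto simp: facet_def intro!: hull_inc)
  have "v m \<in> ?P" for m
  proof (cases "m = i")
    case True
    then show ?thesis using vF[of j] ij by (auto simp: prism_def intro!: image_eqI[of _ _ "(v j, 1)"])
  next
    case False
    then show ?thesis using vF[of m] by (auto simp: prism_def intro!: image_eqI[of _ _ "(v m, 0)"])
  qed
  then have "solid v \<subseteq> ?P"
    unfolding solid_def using \<open>convex ?P\<close> by (intro hull_minimal) auto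
  moreover have "interior (solid v) \<noteq> {}"
  proof -
    have inj: "inj v" and ind: "\<not> affine_dependent (range v)"
      using nd by (auto simp: nondegenerate_simplex_def)
    have "card (range v) = Suc DIM(real ^ 'n)"
      using inj by (simp add: card_image)
    then show ?thesis
      unfolding solid_def using ind by (simp add: interior_convex_hull_eq_empty)
  qed
  ultimately have "interior ?P \<noteq> {}" using interior_mono by blast
  then have "\<not> negligible ?P" using \<open>convex ?P\<close> by (simp add: negligible_convex_interior)
  moreover have "compact ?P" by (rule compact_prism[OF F(1)])
  ultimately show ?thesis
    using negligible_iff_measure[of ?P] lmeasurable_compact[of ?P] borel_compact[of ?P]
    by (simp add: less_le)
qed

text \<open>
  The prism over facet \<open>i\<close> along an edge \<open>v i - v j\<close> has volume \<open>relative_volume (facet v i) / norm (d i)\<close>,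
  whatever \<open>j\<close> is; by the exchange of vertices it is also the volume of the prism over facet \<open>j\<close>.
  So the ratio of \<open>relative_volume (facet v i)\<close> to \<open>norm (d i)\<close> is the same for all facets, namely
  \<open>n\<close> times the volume of the simplex.
\<close>

lemma outward_normals_eq:
  fixes v k :: "'n::finite option \<Rightarrow> real ^ 'n"
  assumes nd: "nondegenerate_simplex v" and d: "barycentric_gradients v d"
    and k: "\<And>i. normalized_outward_normal v i (k i)"
  obtains c where "0 < c" "\<And>i. k i = (- c) *\<^sub>R d i"
proof -
  have dd: "d i \<bullet> (v j - v l) = of_bool (i = j) - of_bool (i = l)" for i j l
    using d by (simp add: barycentric_gradients_def)
  have ne: "\<exists>j. j \<noteq> i" for i :: "'n option" by (cases i) auto
  have d0: "d i \<noteq> 0" for i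
  proof -
    obtain j where "j \<noteq> i" using ne by blast
    then show ?thesis using dd[of i i j] by auto
  qed
  define V where "V i j = measure lborel (prism (facet v i) (v i - v j))" for i j
  have vol: "relative_volume (facet v i) = V i j * norm (d i)" if ij: "i \<noteq> j" for i j
  proof -
    let ?u = "(1 / norm (d i)) *\<^sub>R d i"
    have "?u \<bullet> (v i - v j) = 1 / norm (d i)" using dd[of i i j] ij by simp
    moreover have "V i j = \<bar>?u \<bullet> (v i - v j)\<bar> * relative_volume (facet v i)"
      unfolding V_def
    proof (rule measure_prism[OF facet_geometry(1,2)[OF nd d] _ _ facet_geometry(4)[OF nd d]])
      show "norm ?u = 1" using d0 by simp
      show "?u \<bullet> (v i - v j) \<noteq> 0" using dd[of i i j] ij d0 by simp
      show "\<And>x y. x \<in> facet v i \<Longrightarrow> y \<in> facet v i \<Longrightarrow> ?u \<bullet> (x - y) = 0"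
        using facet_geometry(3)[OF nd d] by simp
    qed
    ultimately show ?thesis using d0[of i] by simp
  qed
  define i0 :: "'n option" where "i0 = None"
  obtain j0 where ij0: "j0 \<noteq> i0" using ne by blast
  define c where "c = V i0 j0"
  have "0 < c" unfolding c_def V_def by (rule measure_facet_prism_pos[OF nd ij0[symmetric]])
  have V0: "V i0 j = c" if "j \<noteq> i0" for j
    using vol[OF that[symmetric]] vol[OF ij0[symmetric]] d0[of i0] by (simp add: c_def)
  have c: "relative_volume (facet v i) = c * norm (d i)" for i
  proof (cases "i = i0")
    case True
    then show ?thesis using vol[OF ij0[symmetric]] by (simp add: c_def)
  next
    case False
    then have "V i i0 = V i0 i" unfolding V_def by (rule facet_prism_swap[OF d])
    then show ?thesis using vol[OF False] V0[OF False] by simp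
  qed
  have "k i = (- c) *\<^sub>R d i" for i
  proof -
    have perp: "k i \<bullet> (x - y) = 0" if "x \<in> facet v i" "y \<in> facet v i" for x y
      using k[of i] that unfolding normalized_outward_normal_def by blast
    have out: "k i \<bullet> (y - x) \<le> 0" if "x \<in> facet v i" "y \<in> solid v" for x y
      using k[of i] that unfolding normalized_outward_normal_def by blast
    have nrm: "norm (k i) = c * norm (d i)"
      using k[of i] c[of i] unfolding normalized_outward_normal_def by simp
    obtain m where m: "m \<noteq> i" using ne by blast
    have vF: "v j \<in> facet v i" if "j \<noteq> i" for j
      using that by (auto simp: facet_def intro!: hull_inc)
    have vS: "v j \<in> solid v" for j by (auto simp: solid_def intro!: hull_inc)
    define r where "r = k i \<bullet> (v i - v m)"
    have "r \<le> 0" unfolding r_def by (rule out[OF vF[OF m] vS])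
    have eq: "k i \<bullet> v j = k i \<bullet> v m" if "j \<noteq> i" for j
      using perp[OF vF[OF that] vF[OF m]] by (simp add: inner_diff_right)
    have lin: "k i \<bullet> v j = k i \<bullet> v m + r * of_bool (i = j)" for j
      using eq[of j] by (cases "j = i") (simp_all add: r_def inner_diff_right)
    have "(k i - r *\<^sub>R d i) \<bullet> (v j - v l) = 0" for j l
    proof -
      have "(k i - r *\<^sub>R d i) \<bullet> (v j - v l) = k i \<bullet> v j - k i \<bullet> v l - r * (d i \<bullet> (v j - v l))"
        by (simp add: inner_diff_left inner_diff_right right_diff_distrib)
      also have "\<dots> = 0"
        unfolding dd lin[of j] lin[of l] by (simp add: algebra_simps)
      finally show ?thesis .
    qed
    then have kr: "k i = r *\<^sub>R d i"
      using orthogonal_to_edges_imp_zero[OF nd, of "k i - r *\<^sub>R d i"] by simp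
    have "\<bar>r\<bar> = c" using nrm kr d0[of i] by simp
    then have "r = - c" using \<open>r \<le> 0\<close> by simp
    then show ?thesis using kr by simp
  qed
  then show thesis using that \<open>0 < c\<close> by blast
qed

section \<open>Barycentric coordinates\<close>

text \<open>
  Up to a factor this is the relation that the normalized outward normals sum to zero.
\<close>

lemma sum_gradients_zero:
  fixes v :: "'n::finite option \<Rightarrow> real ^ 'n"
  assumes nd: "nondegenerate_simplex v" and d: "barycentric_gradients v d"
  shows "(\<Sum>i\<in>UNIV. d i) = 0"
proof (rule orthogonal_to_edges_imp_zero[OF nd])
  fix j l
  have "(\<Sum>i\<in>UNIV. d i) \<bullet> (v j - v l) = (\<Sum>i\<in>UNIV. of_bool (i = j) - of_bool (i = l))"
    using d by (simp add: inner_sum_left barycentric_gradients_def)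
  also have "\<dots> = (0 :: real)" by (simp add: sum_subtractf)
  finally show "(\<Sum>i\<in>UNIV. d i) \<bullet> (v j - v l) = 0" .
qed

text \<open>
  Equivalently \<open>\<Sum>\<^sub>i v i (d i)\<^sup>T\<close> is the identity matrix; it suffices to test its transpose on
  the edge vectors.
\<close>

lemma gradient_expansion:
  fixes v :: "'n::finite option \<Rightarrow> real ^ 'n"
  assumes nd: "nondegenerate_simplex v" and d: "barycentric_gradients v d"
  shows "(\<Sum>i\<in>UNIV. (d i \<bullet> x) *\<^sub>R v i) = x"
proof -
  define y where "y = (\<Sum>i\<in>UNIV. (d i \<bullet> x) *\<^sub>R v i) - x"
  have "z \<bullet> y = 0" for z
  proof -
    let ?w = "(\<Sum>i\<in>UNIV. (z \<bullet> v i) *\<^sub>R d i) - z"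
    have "?w = 0"
    proof (rule orthogonal_to_edges_imp_zero[OF nd])
      fix j l
      have "?w \<bullet> (v j - v l) = (\<Sum>i\<in>UNIV. (z \<bullet> v i) * (of_bool (i = j) - of_bool (i = l))) - z \<bullet> (v j - v l)"
        using d by (simp add: inner_diff_left inner_sum_left barycentric_gradients_def)
      also have "\<dots> = 0"
        by (simp add: right_diff_distrib sum_subtractf inner_diff_right)
      finally show "?w \<bullet> (v j - v l) = 0" .
    qed
    then have "z \<bullet> x = (\<Sum>i\<in>UNIV. (z \<bullet> v i) *\<^sub>R d i) \<bullet> x" by simp
    then show ?thesis
      by (simp add: y_def inner_diff_right inner_sum_left inner_sum_right mult.commute)
  qed
  from this[of y] show ?thesis by (simp add: y_def)
qed

text \<open>
  The \<open>i\<close>-th barycentric coordinate. The base vertex \<open>None\<close> is immaterial: an affine function is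
  determined by its gradient and one value.
\<close>

definition bary :: "('n::finite option \<Rightarrow> real ^ 'n) \<Rightarrow> ('n option \<Rightarrow> real ^ 'n) \<Rightarrow> 'n option \<Rightarrow> real ^ 'n \<Rightarrow> real" where
  "bary v d i x = d i \<bullet> (x - v None) + of_bool (i = None)"

lemma bary_vertex: "barycentric_gradients v d \<Longrightarrow> bary v d i (v j) = of_bool (i = j)"
  by (simp add: bary_def barycentric_gradients_def)

lemma bary_diff: "bary v d i x - bary v d i y = d i \<bullet> (x - y)"
  by (simp add: bary_def inner_diff_right)

lemma bary_affine_combination:
  assumes "finite J" "sum a J = 1"
  shows "bary v d i (\<Sum>j\<in>J. a j *\<^sub>R x j) = (\<Sum>j\<in>J. a j * bary v d i (x j))"
proof -
  have "(\<Sum>j\<in>J. a j * bary v d i (x j)) = (\<Sum>j\<in>J. a j * (d i \<bullet> x j)) + sum a J * (of_bool (i = None) - d i \<bullet> v None)"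
    unfolding sum_distrib_right sum.distrib[symmetric]
    by (intro sum.cong) (auto simp: bary_def inner_diff_right algebra_simps)
  then show ?thesis using assms(2) by (simp add: bary_def inner_diff_right inner_sum_right)
qed

lemma bary_sum:
  fixes v :: "'n::finite option \<Rightarrow> real ^ 'n"
  assumes nd: "nondegenerate_simplex v" and d: "barycentric_gradients v d"
  shows "(\<Sum>i\<in>UNIV. bary v d i x) = 1" "(\<Sum>i\<in>UNIV. bary v d i x *\<^sub>R v i) = x"
proof -
  show "(\<Sum>i\<in>UNIV. bary v d i x) = 1"
    using sum_gradients_zero[OF nd d]
    by (simp add: bary_def sum.distrib inner_sum_left[symmetric])
  have "(\<Sum>i\<in>UNIV. bary v d i x *\<^sub>R v i)
      = (\<Sum>i\<in>UNIV. (d i \<bullet> (x - v None)) *\<^sub>R v i) + (\<Sum>i\<in>UNIV. (of_bool (i = None) :: real) *\<^sub>R v i)"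
    by (simp only: bary_def scaleR_left_distrib sum.distrib)
  also have "(\<Sum>i\<in>UNIV. (of_bool (i = None) :: real) *\<^sub>R v i) = v None"
    by (simp add: of_bool_def if_distrib[of "\<lambda>r. r *\<^sub>R _"] cong: if_cong)
  finally show "(\<Sum>i\<in>UNIV. bary v d i x *\<^sub>R v i) = x"
    by (simp add: gradient_expansion[OF nd d])
qed

lemma affine_hull_facet:
  fixes v :: "'n::finite option \<Rightarrow> real ^ 'n"
  assumes nd: "nondegenerate_simplex v" and d: "barycentric_gradients v d"
  shows "affine hull (facet v i) = {x. bary v d i x = 0}"
proof -
  have hull: "affine hull (facet v i) = affine hull (v ` (UNIV - {i}))"
    by (simp add: facet_def)
  show ?thesis
  proof (intro equalityI subsetI)
    have "affine {x. d i \<bullet> x = d i \<bullet> v None - of_bool (i = None)}" by (rule affine_hyperplane)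
    moreover have "{x. d i \<bullet> x = d i \<bullet> v None - of_bool (i = None)} = {x. bary v d i x = 0}"
      by (auto simp: bary_def inner_diff_right)
    ultimately have "affine {x. bary v d i x = 0}" by simp
    moreover have "v ` (UNIV - {i}) \<subseteq> {x. bary v d i x = 0}"
      using bary_vertex[OF d] by auto
    ultimately have "affine hull (facet v i) \<subseteq> {x. bary v d i x = 0}"
      unfolding hull by (simp add: hull_minimal)
    then show "x \<in> {x. bary v d i x = 0}" if "x \<in> affine hull (facet v i)" for x using that by auto
  next
    fix x assume "x \<in> {x. bary v d i x = 0}"
    then have x: "bary v d i x = 0" by simp
    have 1: "(\<Sum>j\<in>UNIV - {i}. bary v d j x) = 1"
      using bary_sum(1)[OF nd d, of x] x by (simp add: sum_diff1)
    have 2: "(\<Sum>j\<in>UNIV - {i}. bary v d j x *\<^sub>R v j) = x"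
      using bary_sum(2)[OF nd d, of x] x by (simp add: sum_diff1)
    have inj: "inj v" using nd by (simp add: nondegenerate_simplex_def)
    let ?u = "\<lambda>y. bary v d (inv v y) x"
    have "sum ?u (v ` (UNIV - {i})) = 1" "(\<Sum>y\<in>v ` (UNIV - {i}). ?u y *\<^sub>R y) = x"
      using 1 2 inj by (simp_all add: sum.reindex inj_on_subset[OF inj])
    then have "x \<in> affine hull (v ` (UNIV - {i}))"
      by (subst affine_hull_finite) auto
    then show "x \<in> affine hull (facet v i)" by (simp only: hull)
  qed
qed

lemma positive_bary_interior:
  fixes v :: "'n::finite option \<Rightarrow> real ^ 'n"
  assumes nd: "nondegenerate_simplex v" and d: "barycentric_gradients v d"
    and pos: "\<And>i. 0 < bary v d i x"
  shows "x \<in> interior (solid v)"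
proof (rule interiorI)
  let ?U = "\<Inter>i. {x. 0 < bary v d i x}"
  show "open ?U"
    unfolding bary_def by (intro open_INT ballI open_Collect_less continuous_intros) auto
  show "x \<in> ?U" using pos by auto
  show "?U \<subseteq> solid v"
  proof
    fix y assume "y \<in> ?U"
    then have "0 \<le> bary v d i y" for i by (auto intro: less_imp_le)
    then have "(\<Sum>i\<in>UNIV. bary v d i y *\<^sub>R v i) \<in> convex hull range v"
      using bary_sum(1)[OF nd d, of y] by (intro convex_sum) (auto intro: hull_inc)
    then show "y \<in> solid v" by (simp add: solid_def bary_sum(2)[OF nd d])
  qed
qed

lemma bary_facet_centroid:
  fixes v :: "'n::finite option \<Rightarrow> real ^ 'n"
  assumes d: "barycentric_gradients v d"
  shows "bary v d j (facet_centroid v i) = (if j = i then 0 else 1 / real CARD('n))"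
proof -
  have "facet_centroid v i = (\<Sum>l\<in>UNIV - {i}. (1 / real CARD('n)) *\<^sub>R v l)"
    by (simp add: facet_centroid_def scaleR_sum_right)
  then have "bary v d j (facet_centroid v i) = (\<Sum>l\<in>UNIV - {i}. 1 / real CARD('n) * bary v d j (v l))"
    by (simp add: bary_affine_combination card_Diff_singleton)
  also have "\<dots> = (\<Sum>l\<in>UNIV - {i}. if l = j then 1 / real CARD('n) else 0)"
    by (intro sum.cong) (auto simp: bary_vertex[OF d])
  also have "\<dots> = (if j = i then 0 else 1 / real CARD('n))"
    by simp
  finally show ?thesis .
qed

section \<open>Symmetric and traceless matrices\<close>

lemma exists_symmetric_function:
  fixes M :: "real ^ 'n ^ 'n"
  assumes "transpose M = M"
  obtains m where "\<And>a b. M $ a $ b = m {a, b}"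
proof -
  have sym: "M $ a $ b = M $ b $ a" for a b
    using assms by (metis transpose_def vec_lambda_beta)
  define m where "m s = (THE r. \<exists>a b. s = {a, b} \<and> r = M $ a $ b)" for s
  have "m {a, b} = M $ a $ b" for a b
    unfolding m_def using sym by (intro the_equality) (auto simp: doubleton_eq_iff)
  then show thesis using that by metis
qed

text \<open>
  The matrices \<open>E s\<close> are indexed by the unordered pairs \<open>s\<close> of not necessarily distinct indices, that is
  by the sets of one or two elements, so that no order on the index type is required.
\<close>

lemma dim_symmetric_matrices:
  "2 * dim {M :: real ^ 'n ^ 'n. transpose M = M} = CARD('n::finite) * (CARD('n) + 1)"
proof -
  let ?Sym = "{M :: real ^ 'n ^ 'n. transpose M = M}"
  define S where "S = {s :: 'n set. card s = 1} \<union> {s. card s = 2}"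
  define E :: "'n set \<Rightarrow> real ^ 'n ^ 'n" where "E s = (\<chi> a b. of_bool ({a, b} = s))" for s
  have E: "E s $ a $ b = of_bool ({a, b} = s)" for s a b by (simp add: E_def)
  have inS: "{a, b} \<in> S" for a b by (cases "a = b") (auto simp: S_def)
  have S_ex: "\<exists>a b. s = {a, b}" if "s \<in> S" for s
    using that by (auto simp: S_def card_1_singleton_iff card_2_iff)
  have E_ne: "E s \<noteq> 0" if s: "s \<in> S" for s
  proof -
    obtain a b where "s = {a, b}" using S_ex[OF s] by blast
    then have "E s $ a $ b = 1" by (simp add: E)
    then show ?thesis by auto
  qed
  have orth: "E s \<bullet> E t = 0" if "s \<noteq> t" for s t
    using that by (auto simp: inner_vec_def E intro!: sum.neutral)
  have inj: "inj_on E S"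
    by (rule inj_onI) (metis E_ne orth inner_eq_zero_iff)
  have "pairwise orthogonal (E ` S)"
    by (auto simp: pairwise_def orthogonal_def intro!: orth)
  then have ind: "independent (E ` S)"
    by (rule pairwise_orthogonal_independent) (use E_ne in auto)
  have sub: "E ` S \<subseteq> ?Sym"
    by (auto simp: vec_eq_iff transpose_def E insert_commute)
  have span: "?Sym \<subseteq> span (E ` S)"
  proof
    fix M assume "M \<in> ?Sym"
    then obtain m where m: "\<And>a b. M $ a $ b = m {a, b}"
      using exists_symmetric_function by blast
    have "M = (\<Sum>s\<in>S. m s *\<^sub>R E s)"
    proof -
      have "(\<Sum>s\<in>S. m s *\<^sub>R E s) $ a $ b = M $ a $ b" for a b
      proof -
        have "(\<Sum>s\<in>S. m s *\<^sub>R E s) $ a $ b = (\<Sum>s\<in>S. if s = {a, b} then m s else 0)"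
          unfolding sum_component vector_scaleR_component E by (intro sum.cong) auto
        also have "\<dots> = M $ a $ b" using inS by (simp add: m S_def)
        finally show ?thesis .
      qed
      then show ?thesis by (simp add: vec_eq_iff)
    qed
    also have "\<dots> \<in> span (E ` S)" by (intro span_sum span_scale span_base) auto
    finally show "M \<in> span (E ` S)" .
  qed
  have "dim ?Sym = card (E ` S)" by (rule dim_unique[OF sub span ind refl])
  also have "\<dots> = card S" by (rule card_image[OF inj])
  also have "\<dots> = card {s :: 'n set. card s = 1} + card {s :: 'n set. card s = 2}"
    unfolding S_def by (intro card_Un_disjoint) auto
  also have "\<dots> = CARD('n) + (CARD('n) choose 2)"
    using n_subsets[of "UNIV :: 'n set" 1] n_subsets[of "UNIV :: 'n set" 2] by simp
  finally have "2 * dim ?Sym = 2 * CARD('n) + 2 * (CARD('n) choose 2)" by simp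
  also have "2 * (CARD('n) choose 2) = CARD('n) * (CARD('n) - 1)" by (simp add: choose_two)
  also have "2 * CARD('n) + CARD('n) * (CARD('n) - 1) = CARD('n) * (CARD('n) + 1)"
    by (cases "CARD('n)") auto
  finally show ?thesis .
qed

lemma inner_mat_1: "(M :: real ^ 'n ^ 'n::finite) \<bullet> mat 1 = trace M"
  by (simp add: inner_vec_def mat_def trace_def if_distrib cong: if_cong)

lemma subspace_symmetric_matrices: "subspace {M :: real ^ 'n ^ 'n::finite. transpose M = M}"
  by (auto simp: subspace_def transpose_def vec_eq_iff)

text \<open>
  The trace of \<open>M\<close> is the inner product of \<open>M\<close> with the identity matrix, so the symmetric traceless
  matrices form a hyperplane in the space of symmetric ones.
\<close>

lemma dim_symmetric_traceless:
  "2 * (dim {M :: real ^ 'n ^ 'n. transpose M = M \<and> trace M = 0} + 1) = CARD('n::finite) * (CARD('n) + 1)"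
proof -
  let ?Sym = "{M :: real ^ 'n ^ 'n. transpose M = M}" and ?I = "mat 1 :: real ^ 'n ^ 'n"
  have I0: "?I \<noteq> 0" by (auto simp: vec_eq_iff mat_def)
  have "dim {M \<in> ?Sym. \<forall>N\<in>span {?I}. orthogonal N M} + dim (span {?I}) = dim ?Sym"
  proof (rule dim_subspace_orthogonal_to_vectors[OF subspace_span subspace_symmetric_matrices])
    show "span {?I} \<subseteq> ?Sym"
      using subspace_symmetric_matrices by (intro span_minimal) (auto simp: transpose_mat)
  qed
  moreover have "{M \<in> ?Sym. \<forall>N\<in>span {?I}. orthogonal N M} = {M. transpose M = M \<and> trace M = 0}"
  proof -
    have "(\<forall>N\<in>span {?I}. orthogonal N M) \<longleftrightarrow> trace M = 0" for M
      by (auto simp: span_singleton orthogonal_def inner_mat_1 inner_commute[of _ M])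
    then show ?thesis by auto
  qed
  moreover have "dim (span {?I}) = 1"
    using I0 by (simp add: dim_eq_card_independent)
  ultimately show ?thesis using dim_symmetric_matrices[where 'n='n] by simp
qed

section \<open>The equilibrium space\<close>

text \<open>
  The normals are a common negative multiple of the gradients \<open>d i\<close>, so for these \<open>d\<close> the matrix \<open>A\<close>
  in \<open>equilibrium_space\<close> is the same multiple of this one.
\<close>

definition moment :: "('m::finite \<Rightarrow> real ^ 'n::finite) \<Rightarrow> real ^ 'n ^ 'm \<Rightarrow> real ^ 'n ^ 'n" where
  "moment d q = (\<Sum>i\<in>UNIV. outer_product (d i) (q $ i))"

lemma outer_product_component: "outer_product x y $ a $ b = x $ a * y $ b"
  by (simp add: outer_product_def matrix_matrix_mult_def columnvector_def rowvector_def)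

lemma moment_component: "moment d q $ a $ b = (\<Sum>i\<in>UNIV. d i $ a * q $ i $ b)"
  by (simp add: moment_def outer_product_component)

lemma linear_moment: "linear (moment d)"
  by (rule linearI)
     (simp_all add: vec_eq_iff moment_component sum.distrib distrib_left sum_distrib_left mult.left_commute)

text \<open>
  With \<open>M = R - mat 1\<close> this turns the total displacement of the points along the directions \<open>d i\<close>, which
  is what non-penetration bounds, into an inner product with the moment matrix.
\<close>

lemma moment_inner: "moment d q \<bullet> M = (\<Sum>i\<in>UNIV. d i \<bullet> (M *v q $ i))"
proof -
  have "moment d q \<bullet> M = (\<Sum>a\<in>UNIV. \<Sum>b\<in>UNIV. \<Sum>i\<in>UNIV. d i $ a * q $ i $ b * M $ a $ b)"
    by (simp add: inner_vec_def moment_component sum_distrib_right)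
  also have "\<dots> = (\<Sum>a\<in>UNIV. \<Sum>i\<in>UNIV. \<Sum>b\<in>UNIV. d i $ a * q $ i $ b * M $ a $ b)"
    by (intro sum.cong sum.swap refl)
  also have "\<dots> = (\<Sum>i\<in>UNIV. \<Sum>a\<in>UNIV. \<Sum>b\<in>UNIV. d i $ a * q $ i $ b * M $ a $ b)"
    by (rule sum.swap)
  also have "\<dots> = (\<Sum>i\<in>UNIV. d i \<bullet> (M *v q $ i))"
    by (simp add: inner_vec_def matrix_vector_mult_def sum_distrib_left mult_ac)
  finally show ?thesis .
qed

lemma trace_moment: "trace (moment d q) = (\<Sum>i\<in>UNIV. d i \<bullet> q $ i)"
  by (simp add: inner_mat_1[symmetric] moment_inner)

lemma moment_vertices:
  fixes v :: "'n::finite option \<Rightarrow> real ^ 'n"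
  assumes nd: "nondegenerate_simplex v" and d: "barycentric_gradients v d"
  shows "moment d (\<chi> i. v i) = mat 1"
proof -
  have "moment d (\<chi> i. v i) $ a $ b = mat 1 $ a $ b" for a b
  proof -
    have "moment d (\<chi> i. v i) $ a $ b = (\<Sum>i\<in>UNIV. (d i \<bullet> axis a 1) *\<^sub>R v i) $ b"
      by (simp add: moment_component inner_axis)
    also have "\<dots> = mat 1 $ a $ b"
      by (simp add: gradient_expansion[OF nd d] axis_def mat_def)
    finally show ?thesis .
  qed
  then show ?thesis by (simp add: vec_eq_iff)
qed

lemma moment_const:
  fixes v :: "'n::finite option \<Rightarrow> real ^ 'n"
  assumes nd: "nondegenerate_simplex v" and d: "barycentric_gradients v d"
  shows "moment d (\<chi> i. b) = 0"
proof -
  have "moment d (\<chi> i. b) $ a $ a' = (\<Sum>i\<in>UNIV. d i) $ a * b $ a'" for a a'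
    by (simp add: moment_component sum_distrib_right)
  then show ?thesis by (simp add: vec_eq_iff sum_gradients_zero[OF nd d])
qed

lemma moment_centroids:
  fixes v :: "'n::finite option \<Rightarrow> real ^ 'n"
  assumes nd: "nondegenerate_simplex v" and d: "barycentric_gradients v d"
  shows "moment d (\<chi> i. facet_centroid v i) = (- 1 / real CARD('n)) *\<^sub>R mat 1"
proof -
  have "(\<chi> i. facet_centroid v i)
      = (1 / real CARD('n)) *\<^sub>R ((\<chi> i. \<Sum>j\<in>UNIV. v j) - (\<chi> i. v i))"
    by (simp add: vec_eq_iff facet_centroid_def sum_diff1)
  then have "moment d (\<chi> i. facet_centroid v i)
      = (1 / real CARD('n)) *\<^sub>R (moment d (\<chi> i. \<Sum>j\<in>UNIV. v j) - moment d (\<chi> i. v i))"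
    by (simp only: linear_scale[OF linear_moment] linear_diff[OF linear_moment])
  then show ?thesis by (simp add: moment_const[OF nd d] moment_vertices[OF nd d])
qed

definition equilibrium_directions :: "('n::finite option \<Rightarrow> real ^ 'n) \<Rightarrow> (real ^ 'n ^ 'n option) set" where
  "equilibrium_directions d = {q. (\<forall>i. d i \<bullet> q $ i = 0) \<and> transpose (moment d q) = moment d q}"

lemma linear_transpose: "linear (transpose :: real ^ 'n ^ 'm \<Rightarrow> real ^ 'm ^ 'n)"
  by (rule linearI) (simp_all add: transpose_def vec_eq_iff)

lemma subspace_equilibrium_directions: "subspace (equilibrium_directions d)"
  unfolding equilibrium_directions_def subspace_def
  by (simp add: linear_0[OF linear_moment] linear_add[OF linear_moment] linear_scale[OF linear_moment]
      linear_0[OF linear_transpose] linear_add[OF linear_transpose] linear_scale[OF linear_transpose] inner_add_right)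

text \<open>
  A zero moment applied to the edge from \<open>v j\<close> to \<open>v l\<close> gives \<open>q $ j = q $ l\<close>. A common value of all
  entries that is orthogonal to every \<open>d i\<close> is zero, as the \<open>d i\<close> span the space.
\<close>

lemma moment_kernel:
  fixes v :: "'n::finite option \<Rightarrow> real ^ 'n"
  assumes nd: "nondegenerate_simplex v" and d: "barycentric_gradients v d"
    and tangent: "\<And>i. d i \<bullet> q $ i = 0" and zero: "moment d q = 0"
  shows "q = 0"
proof -
  have *: "(\<Sum>i\<in>UNIV. (d i \<bullet> w) *\<^sub>R q $ i) = 0" for w
  proof -
    have "(\<Sum>i\<in>UNIV. (d i \<bullet> w) *\<^sub>R q $ i) $ b = (\<Sum>a\<in>UNIV. w $ a * moment d q $ a $ b)" for b
    proof -
      have "(\<Sum>i\<in>UNIV. (d i \<bullet> w) *\<^sub>R q $ i) $ b = (\<Sum>i\<in>UNIV. \<Sum>a\<in>UNIV. w $ a * (d i $ a * q $ i $ b))"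
        by (simp add: inner_vec_def sum_distrib_left mult_ac)
      also have "\<dots> = (\<Sum>a\<in>UNIV. \<Sum>i\<in>UNIV. w $ a * (d i $ a * q $ i $ b))"
        by (rule sum.swap)
      finally show ?thesis by (simp add: moment_component sum_distrib_left)
    qed
    then show ?thesis by (simp add: zero vec_eq_iff)
  qed
  have eq: "q $ j = q $ None" for j
  proof -
    have "(\<Sum>i\<in>UNIV. (d i \<bullet> (v j - v None)) *\<^sub>R q $ i)
        = (\<Sum>i\<in>UNIV. (if i = j then q $ i else 0)) - (\<Sum>i\<in>UNIV. (if i = None then q $ i else 0))"
      unfolding sum_subtractf[symmetric]
      using d by (intro sum.cong) (auto simp: barycentric_gradients_def)
    then show ?thesis using *[of "v j - v None"] by simp
  qed
  have "d i \<bullet> q $ None = 0" for i using tangent[of i] by (simp only: eq[of i])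
  then have "q $ None = 0" using gradient_expansion[OF nd d, of "q $ None"] by simp
  then show ?thesis using eq by (simp add: vec_eq_iff)
qed

text \<open>
  The choice \<open>q $ i = M\<^sup>T v i\<close> has moment \<open>M\<close>, since the vertices have moment \<open>mat 1\<close>, and a common
  translation by a vector \<open>b\<close> does not change the moment. The conditions \<open>d i \<bullet> q $ i = 0\<close> then
  prescribe \<open>d i \<bullet> b\<close> for all \<open>i\<close>; as the \<open>d i\<close> sum to zero, this is possible because the prescribed values
  do as well, and their sum is \<open>- trace M\<close>.
\<close>

lemma moment_surjective:
  fixes v :: "'n::finite option \<Rightarrow> real ^ 'n"
  assumes nd: "nondegenerate_simplex v" and d: "barycentric_gradients v d"
    and M: "trace M = 0"
  obtains q where "\<And>i. d i \<bullet> q $ i = 0" "moment d q = M"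
proof -
  let ?N = "transpose M"
  define g where "g i = - (d i \<bullet> (?N *v v i))" for i
  \<comment> \<open>by duality \<open>d i \<bullet> b = g i\<close>, up to a multiple of the sum of \<open>g\<close>, which vanishes\<close>
  define b where "b = (\<Sum>m\<in>UNIV. g m *\<^sub>R v m)"
  define q where "q = (\<chi> i. ?N *v v i) + (\<chi> i. b)"
  have "(\<Sum>i\<in>UNIV. d i \<bullet> (?N *v v i)) = moment d (\<chi> i. v i) \<bullet> ?N"
    by (simp add: moment_inner)
  also have "\<dots> = 0"
    using M by (simp add: moment_vertices[OF nd d] inner_commute[of "mat 1"] inner_mat_1 trace_def transpose_def)
  finally have g0: "sum g UNIV = 0" by (simp add: g_def sum_negf)
  have "d i \<bullet> q $ i = 0" for i
  proof -
    have "d i \<bullet> b = (\<Sum>m\<in>UNIV. g m * (of_bool (i = m) + (d i \<bullet> v None - of_bool (i = None))))"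
      unfolding b_def inner_sum_right inner_scaleR_right
    proof (intro sum.cong refl)
      fix m
      have "d i \<bullet> (v m - v None) = of_bool (i = m) - of_bool (i = None)"
        using d by (simp add: barycentric_gradients_def)
      then show "g m * (d i \<bullet> v m) = g m * (of_bool (i = m) + (d i \<bullet> v None - of_bool (i = None)))"
        by (simp add: inner_diff_right)
    qed
    also have "\<dots> = g i + sum g UNIV * (d i \<bullet> v None - of_bool (i = None))"
      by (simp add: distrib_left sum.distrib sum_distrib_right)
    also have "\<dots> = g i" by (simp add: g0)
    finally show ?thesis by (simp add: q_def inner_add_right g_def)
  qed
  moreover have "moment d q = M"
  proof -
    have "moment d q = moment d (\<chi> i. ?N *v v i)"
      by (simp add: q_def linear_add[OF linear_moment] moment_const[OF nd d])
    also have "\<dots> = moment d (\<chi> i. v i) ** M"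
    proof -
      have "moment d (\<chi> i. ?N *v v i) $ a $ b = (moment d (\<chi> i. v i) ** M) $ a $ b" for a b
      proof -
        have "moment d (\<chi> i. ?N *v v i) $ a $ b = (\<Sum>i\<in>UNIV. \<Sum>c\<in>UNIV. d i $ a * v i $ c * M $ c $ b)"
          by (simp add: moment_component matrix_vector_mult_def transpose_def sum_distrib_left mult_ac)
        also have "\<dots> = (\<Sum>c\<in>UNIV. \<Sum>i\<in>UNIV. d i $ a * v i $ c * M $ c $ b)"
          by (rule sum.swap)
        finally show ?thesis
          by (simp add: matrix_matrix_mult_def moment_component sum_distrib_right)
      qed
      then show ?thesis by (simp add: vec_eq_iff)
    qed
    finally show ?thesis by (simp add: moment_vertices[OF nd d])
  qed
  ultimately show thesis using that by blast
qed

text \<open>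
  The moment map is injective on the tangential tuples and has the traceless matrices as
  its image there, so the symmetric moments correspond to the symmetric traceless matrices.
\<close>

lemma dim_equilibrium_directions:
  fixes v :: "'n::finite option \<Rightarrow> real ^ 'n"
  assumes nd: "nondegenerate_simplex v" and d: "barycentric_gradients v d"
  shows "2 * (dim (equilibrium_directions d) + 1) = CARD('n) * (CARD('n) + 1)"
proof -
  have "moment d ` equilibrium_directions d = {M. transpose M = M \<and> trace M = 0}"
  proof (intro equalityI subsetI)
    fix M assume "M \<in> moment d ` equilibrium_directions d"
    then show "M \<in> {M. transpose M = M \<and> trace M = 0}"
      by (auto simp: equilibrium_directions_def trace_moment)
  next
    fix M :: "real ^ 'n ^ 'n" assume "M \<in> {M. transpose M = M \<and> trace M = 0}"
    then have M: "transpose M = M" "trace M = 0" by auto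
    obtain q where "\<And>i. d i \<bullet> q $ i = 0" "moment d q = M"
      using moment_surjective[OF nd d M(2)] by blast
    then show "M \<in> moment d ` equilibrium_directions d"
      using M(1) by (auto simp: equilibrium_directions_def)
  qed
  moreover have "dim (moment d ` equilibrium_directions d) = dim (equilibrium_directions d)"
  proof (rule dim_image_eq[OF linear_moment])
    show "inj_on (moment d) (span (equilibrium_directions d))"
      unfolding span_eq_iff[THEN iffD2, OF subspace_equilibrium_directions]
    proof (subst linear_inj_on_iff_eq_0[OF linear_moment subspace_equilibrium_directions], intro ballI impI)
      fix q assume "q \<in> equilibrium_directions d" "moment d q = 0"
      then show "q = 0" by (intro moment_kernel[OF nd d]) (auto simp: equilibrium_directions_def)
    qed
  qed
  ultimately show ?thesis using dim_symmetric_traceless[where 'n='n] by simp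
qed

lemma equilibrium_space_eq:
  fixes v k :: "'n::finite option \<Rightarrow> real ^ 'n"
  assumes nd: "nondegenerate_simplex v" and d: "barycentric_gradients v d"
    and c: "0 < c" and k: "\<And>i. k i = (- c) *\<^sub>R d i"
  shows "equilibrium_space v k = {p. (\<forall>i. bary v d i (p $ i) = 0) \<and> transpose (moment d p) = moment d p}"
proof -
  have "(\<Sum>i\<in>UNIV. outer_product (k i) (p $ i)) = (- c) *\<^sub>R moment d p" for p
    by (simp add: vec_eq_iff moment_component outer_product_component k sum_distrib_left sum_negf mult.assoc)
  moreover have "transpose ((- c) *\<^sub>R M) = (- c) *\<^sub>R M \<longleftrightarrow> transpose M = M" for M :: "real ^ 'n ^ 'n"
    using c by (simp only: linear_scale[OF linear_transpose]) simp
  ultimately show ?thesis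
    by (simp only: equilibrium_space_def Let_def affine_hull_facet[OF nd d] mem_Collect_eq)
qed

lemma equilibrium_space_translate:
  fixes v k :: "'n::finite option \<Rightarrow> real ^ 'n"
  assumes nd: "nondegenerate_simplex v" and d: "barycentric_gradients v d"
    and c: "0 < c" and k: "\<And>i. k i = (- c) *\<^sub>R d i"
  shows "equilibrium_space v k = (+) (\<chi> i. facet_centroid v i) ` equilibrium_directions d"
proof -
  let ?G = "\<chi> i. facet_centroid v i"
  have tG: "transpose (moment d ?G) = moment d ?G"
    by (simp add: moment_centroids[OF nd d] linear_scale[OF linear_transpose] transpose_mat del: scaleR_minus_left divide_minus_left)
  have "p \<in> equilibrium_space v k \<longleftrightarrow> p - ?G \<in> equilibrium_directions d" for p
  proof -
    have "bary v d i (p $ i) = d i \<bullet> (p - ?G) $ i" for i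
      using bary_diff[of v d i "p $ i" "facet_centroid v i"] bary_facet_centroid[OF d, of i i] by simp
    moreover have "transpose (moment d p) = moment d p
        \<longleftrightarrow> transpose (moment d (p - ?G)) = moment d (p - ?G)"
      by (simp add: linear_diff[OF linear_moment] linear_diff[OF linear_transpose] tG)
    ultimately show ?thesis
      by (simp only: equilibrium_space_eq[OF nd d c k] equilibrium_directions_def mem_Collect_eq)
  qed
  then have "equilibrium_space v k = {p. p - ?G \<in> equilibrium_directions d}" by blast
  also have "\<dots> = (+) ?G ` equilibrium_directions d"
  proof (intro equalityI subsetI)
    fix p assume "p \<in> {p. p - ?G \<in> equilibrium_directions d}"
    then show "p \<in> (+) ?G ` equilibrium_directions d" by (intro image_eqI[of _ _ "p - ?G"]) auto
  qed auto
  finally show ?thesis .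
qed

section \<open>Immobilization\<close>

lemma norm_squared_rows: "(norm x)\<^sup>2 = (\<Sum>a\<in>UNIV. (norm (x $ a))\<^sup>2)"
  for x :: "'a::real_normed_vector ^ 'm::finite"
  by (simp add: norm_vec_def L2_set_def sum_nonneg)

lemma open_Collect_finite_all:
  fixes P :: "'i::finite \<Rightarrow> 'a::topological_space \<Rightarrow> bool"
  assumes "\<And>i. open {x. P i x}"
  shows "open {x. \<forall>i. P i x}"
  using assms by (simp add: Collect_all_eq open_INT)

lemma norm_matrix_vector_mult_le:
  fixes E :: "real ^ 'n::finite ^ 'm::finite"
  shows "norm (E *v x) \<le> norm E * norm x"
proof (rule power2_le_imp_le)
  have "(norm (E *v x))\<^sup>2 = (\<Sum>a\<in>UNIV. (E $ a \<bullet> x)\<^sup>2)"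
    by (simp add: norm_squared_rows[of "E *v x"] matrix_vector_mul_component)
  also have "\<dots> \<le> (\<Sum>a\<in>UNIV. (norm (E $ a))\<^sup>2 * (norm x)\<^sup>2)"
    by (intro sum_mono) (simp add: power2_norm_eq_inner Cauchy_Schwarz_ineq)
  also have "\<dots> = (norm E * norm x)\<^sup>2"
    by (simp add: power_mult_distrib norm_squared_rows[of E] sum_distrib_right)
  finally show "(norm (E *v x))\<^sup>2 \<le> (norm E * norm x)\<^sup>2" .
qed simp

text \<open>
  For \<open>D = R - mat 1\<close> orthogonality of \<open>R\<close> reads \<open>D + D\<^sup>T = - D\<^sup>T D\<close>. A symmetric matrix \<open>S\<close> sees only
  the symmetric part of \<open>D\<close>, so the first-order term in \<open>D\<close> disappears and a quadratic form in the rows of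
  \<open>D\<close> remains.
\<close>

lemma symmetric_inner_rotation:
  fixes S R :: "real ^ 'n::finite ^ 'n"
  assumes S: "transpose S = S" and R: "orthogonal_matrix R"
  shows "2 * (S \<bullet> (R - mat 1)) = - (\<Sum>r\<in>UNIV. (R - mat 1) $ r \<bullet> (S *v (R - mat 1) $ r))"
proof -
  define D where "D = R - mat 1"
  have Dc: "D $ a $ b = R $ a $ b - of_bool (a = b)" for a b by (simp add: D_def mat_def)
  have RR: "(\<Sum>r\<in>UNIV. R $ r $ a * R $ r $ b) = of_bool (a = b)" for a b
  proof -
    have "(transpose R ** R) $ a $ b = mat 1 $ a $ b" using R by (simp add: orthogonal_matrix)
    then show ?thesis by (simp add: matrix_matrix_mult_def transpose_def mat_def of_bool_def)
  qed
  have DD: "(\<Sum>r\<in>UNIV. D $ r $ a * D $ r $ b) = - D $ a $ b - D $ b $ a" for a b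
  proof -
    have "(\<Sum>r\<in>UNIV. D $ r $ a * D $ r $ b)
        = (\<Sum>r\<in>UNIV. R $ r $ a * R $ r $ b) - (\<Sum>r\<in>UNIV. R $ r $ a * of_bool (r = b))
          - (\<Sum>r\<in>UNIV. of_bool (r = a) * R $ r $ b) + (\<Sum>r\<in>UNIV. of_bool (r = a) * of_bool (r = b))"
      unfolding sum_subtractf[symmetric] sum.distrib[symmetric]
      by (intro sum.cong) (auto simp: Dc algebra_simps)
    also have "\<dots> = - D $ a $ b - D $ b $ a"
      by (simp add: RR Dc)
    finally show ?thesis .
  qed
  have sym: "S $ a $ b = S $ b $ a" for a b
    using arg_cong[OF S, of "\<lambda>M. M $ a $ b"] by (simp add: transpose_def)
  have "(\<Sum>r\<in>UNIV. D $ r \<bullet> (S *v D $ r))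
      = (\<Sum>r\<in>UNIV. \<Sum>a\<in>UNIV. \<Sum>b\<in>UNIV. S $ a $ b * (D $ r $ a * D $ r $ b))"
    by (simp add: inner_vec_def matrix_vector_mult_def sum_distrib_left mult_ac)
  also have "\<dots> = (\<Sum>a\<in>UNIV. \<Sum>r\<in>UNIV. \<Sum>b\<in>UNIV. S $ a $ b * (D $ r $ a * D $ r $ b))"
    by (rule sum.swap)
  also have "\<dots> = (\<Sum>a\<in>UNIV. \<Sum>b\<in>UNIV. \<Sum>r\<in>UNIV. S $ a $ b * (D $ r $ a * D $ r $ b))"
    by (intro sum.cong sum.swap refl)
  also have "\<dots> = (\<Sum>a\<in>UNIV. \<Sum>b\<in>UNIV. S $ a $ b * (- D $ a $ b - D $ b $ a))"
    by (simp only: sum_distrib_left[symmetric] DD)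
  also have "\<dots> = - (\<Sum>a\<in>UNIV. \<Sum>b\<in>UNIV. S $ a $ b * D $ a $ b) - (\<Sum>a\<in>UNIV. \<Sum>b\<in>UNIV. S $ a $ b * D $ b $ a)"
    by (simp add: right_diff_distrib sum_subtractf sum_negf)
  also have "(\<Sum>a\<in>UNIV. \<Sum>b\<in>UNIV. S $ a $ b * D $ b $ a) = (\<Sum>b\<in>UNIV. \<Sum>a\<in>UNIV. S $ a $ b * D $ b $ a)"
    by (rule sum.swap)
  also have "\<dots> = (\<Sum>b\<in>UNIV. \<Sum>a\<in>UNIV. S $ b $ a * D $ b $ a)"
    by (intro sum.cong refl) (rule arg_cong2[where f = "(*)", OF sym refl])
  also have "- (\<Sum>a\<in>UNIV. \<Sum>b\<in>UNIV. S $ a $ b * D $ a $ b) - \<dots> = - 2 * (S \<bullet> D)"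
    by (simp add: inner_vec_def)
  finally show ?thesis by (simp add: D_def)
qed

text \<open>
  The hypothesis keeps \<open>S\<close> so close to \<open>- s\<close> times the identity that it is negative definite.
\<close>

lemma rotation_defect_positive:
  fixes S R :: "real ^ 'n::finite ^ 'n"
  assumes S: "transpose S = S" and near: "norm (S + s *\<^sub>R mat 1) < s"
    and R: "orthogonal_matrix R" "R \<noteq> mat 1"
  shows "0 < S \<bullet> (R - mat 1)"
proof -
  define D where "D = R - mat 1"
  define E where "E = S + s *\<^sub>R mat 1"
  have "x \<bullet> (S *v x) \<le> (norm E - s) * (norm x)\<^sup>2" for x
  proof -
    have "S = E - s *\<^sub>R mat 1" by (simp add: E_def)
    then have "S *v x = E *v x - s *\<^sub>R x"
      by (simp add: matrix_vector_mult_diff_rdistrib scaleR_matrix_vector_assoc[symmetric])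
    then have "x \<bullet> (S *v x) = x \<bullet> (E *v x) - s * (norm x)\<^sup>2"
      by (simp add: inner_diff_right power2_norm_eq_inner)
    also have "x \<bullet> (E *v x) \<le> norm x * norm (E *v x)" by (rule norm_cauchy_schwarz)
    also have "\<dots> \<le> norm x * (norm E * norm x)"
      by (intro mult_left_mono norm_matrix_vector_mult_le) simp
    finally show ?thesis by (simp add: algebra_simps power2_eq_square)
  qed
  then have "(\<Sum>r\<in>UNIV. D $ r \<bullet> (S *v D $ r)) \<le> (\<Sum>r\<in>UNIV. (norm E - s) * (norm (D $ r))\<^sup>2)"
    by (intro sum_mono) auto
  also have "\<dots> = (norm E - s) * (norm D)\<^sup>2"
    by (simp add: norm_squared_rows[of D] sum_distrib_left)
  also have "\<dots> < 0"
    using near R(2) by (intro mult_neg_pos) (auto simp: E_def D_def)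
  finally show ?thesis
    using symmetric_inner_rotation[OF S R(1)] by (simp add: D_def)
qed

text \<open>
  The condition on the coordinates \<open>j \<noteq> i\<close> says that \<open>p $ i\<close> is in the relative interior of its facet;
  it persists under small motions. So a point that does not enter the interior of the simplex does not
  cross the hyperplane of its own facet inwards. Summing these displacements removes the translation \<open>a\<close>, and the
  rotational part has the wrong sign unless \<open>R\<close> is the identity.
\<close>

lemma near_centroids_immobilizes:
  fixes v :: "'n::finite option \<Rightarrow> real ^ 'n"
  assumes nd: "nondegenerate_simplex v" and d: "barycentric_gradients v d"
    and on: "\<And>i. bary v d i (p $ i) = 0" and sym: "transpose (moment d p) = moment d p"
    and near: "norm (moment d p + s *\<^sub>R mat 1) < s"
    and inner: "\<And>i j. j \<noteq> i \<Longrightarrow> 0 < bary v d j (p $ i)"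
  shows "immobilizes p v"
proof -
  let ?W = "{g. \<forall>i j. j \<noteq> i \<longrightarrow> 0 < bary v d j (apply_motion g (p $ i))}"
  have [continuous_intros]: "continuous_on UNIV (\<lambda>g :: (real ^ 'n ^ 'n) \<times> (real ^ 'n). fst g *v y)" for y
    unfolding matrix_vector_mult_def by (intro continuous_intros)
  have "open ?W"
    unfolding bary_def apply_motion_def
    by (intro open_Collect_finite_all open_Collect_imp closed_Collect_const open_Collect_less continuous_intros)
  then have "openin (top_of_set rigid_motions) (rigid_motions \<inter> ?W)"
    by (rule openin_open_Int)
  moreover have "(mat 1, 0) \<in> rigid_motions \<inter> ?W"
    using inner by (auto simp: rigid_motions_def rotation_matrix_def orthogonal_matrix_id apply_motion_def)
  moreover have "\<exists>i. apply_motion g (p $ i) \<in> interior (solid v)"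
    if g: "g \<in> rigid_motions \<inter> ?W" "g \<noteq> (mat 1, 0)" for g
  proof (rule ccontr)
    assume out: "\<nexists>i. apply_motion g (p $ i) \<in> interior (solid v)"
    obtain R a where Ra: "g = (R, a)" by (cases g)
    have R: "orthogonal_matrix R" using g(1) by (simp add: Ra rigid_motions_def rotation_matrix_def)
    have le: "d i \<bullet> ((R - mat 1) *v p $ i) + d i \<bullet> a \<le> 0" for i
    proof -
      obtain j where j: "\<not> 0 < bary v d j (apply_motion g (p $ i))"
        using out positive_bary_interior[OF nd d] by blast
      moreover have "0 < bary v d j (apply_motion g (p $ i))" if "j \<noteq> i"
        using g(1) that by blast
      ultimately have "bary v d i (apply_motion g (p $ i)) \<le> 0"
        by (cases "j = i") (auto simp: not_less)
      then have "d i \<bullet> (apply_motion g (p $ i) - p $ i) \<le> 0"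
        using bary_diff[of v d i "apply_motion g (p $ i)" "p $ i"] on[of i] by simp
      moreover have "apply_motion g (p $ i) - p $ i = (R - mat 1) *v p $ i + a"
        by (simp add: apply_motion_def Ra matrix_vector_mult_diff_rdistrib)
      ultimately show ?thesis by (simp add: inner_add_right)
    qed
    have suma: "(\<Sum>i\<in>UNIV. d i \<bullet> a) = 0"
      by (simp add: inner_sum_left[symmetric] sum_gradients_zero[OF nd d])
    have "moment d p \<bullet> (R - mat 1) = (\<Sum>i\<in>UNIV. d i \<bullet> ((R - mat 1) *v p $ i) + d i \<bullet> a)"
      by (simp add: moment_inner sum.distrib suma)
    also have "\<dots> \<le> 0" using le by (intro sum_nonpos) auto
    finally have R1: "R = mat 1"
      using rotation_defect_positive[OF sym near R] by linarith
    have "d i \<bullet> a \<le> 0" for i using le[of i] by (simp add: R1)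
    then have "d i \<bullet> a = 0" for i
      using suma sum_nonneg_eq_0_iff[of UNIV "\<lambda>i. - (d i \<bullet> a)"] by (simp add: sum_negf)
    then have "a = 0" using gradient_expansion[OF nd d, of a] by simp
    then show False using g(2) R1 Ra by simp
  qed
  ultimately show ?thesis unfolding immobilizes_def by blast
qed

theorem mainTheorem4:
  fixes v k :: "'n::finite option \<Rightarrow> real ^ 'n"
  assumes "nondegenerate_simplex v"
    and "signed_volume v > 0"
    and "\<And>i. normalized_outward_normal v i (k i)"
  shows "affine (equilibrium_space v k)
    \<and> real_of_int (aff_dim (equilibrium_space v k)) = 1 / 2 * real CARD('n) * (real CARD('n) + 1) - 1
    \<and> (\<chi> i. facet_centroid v i) \<in> equilibrium_space v k
    \<and> (\<exists>N. openin (top_of_set (equilibrium_space v k)) N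
          \<and> (\<chi> i. facet_centroid v i) \<in> N
          \<and> (\<forall>p\<in>N. contact_set v p \<longrightarrow> immobilizes p v))"
proof -
  note nd = assms(1)
  obtain d where d: "barycentric_gradients v d" using barycentric_gradients_exist[OF nd] .
  obtain c where c: "0 < c" and k: "\<And>i. k i = (- c) *\<^sub>R d i"
    using outward_normals_eq[OF nd d assms(3)] by metis
  let ?X = "equilibrium_space v k" and ?G = "\<chi> i. facet_centroid v i" and ?s = "1 / real CARD('n)"
  note X = equilibrium_space_eq[OF nd d c k]
  have XG: "?X = (+) ?G ` equilibrium_directions d" by (rule equilibrium_space_translate[OF nd d c k])
  have "affine ?X"
    unfolding XG affine_translation[symmetric]
    by (rule subspace_imp_affine[OF subspace_equilibrium_directions])
  moreover have "real_of_int (aff_dim ?X) = 1 / 2 * real CARD('n) * (real CARD('n) + 1) - 1"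
  proof -
    have "aff_dim ?X = int (dim (equilibrium_directions d))"
      unfolding XG by (simp only: aff_dim_translation_eq aff_dim_subspace[OF subspace_equilibrium_directions])
    moreover have "real (2 * (dim (equilibrium_directions d) + 1)) = real (CARD('n) * (CARD('n) + 1))"
      by (simp only: dim_equilibrium_directions[OF nd d])
    ultimately show ?thesis by (simp add: algebra_simps)
  qed
  moreover have GX: "?G \<in> ?X"
    unfolding XG using subspace_0[OF subspace_equilibrium_directions] by (intro image_eqI[of _ _ 0]) auto
  moreover have "\<exists>N. openin (top_of_set ?X) N \<and> ?G \<in> N \<and> (\<forall>p\<in>N. contact_set v p \<longrightarrow> immobilizes p v)"
  proof -
    let ?W = "{p. norm (moment d p + ?s *\<^sub>R mat 1) < ?s \<and> (\<forall>i j. j \<noteq> i \<longrightarrow> 0 < bary v d j (p $ i))}"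
    have "continuous_on UNIV (moment d)"
      using linear_moment by (intro linear_continuous_on) (simp add: linear_conv_bounded_linear)
    then have "open ?W"
      unfolding bary_def
      by (intro open_Collect_conj open_Collect_finite_all open_Collect_imp closed_Collect_const open_Collect_less continuous_intros) auto
    then have "openin (top_of_set ?X) (?X \<inter> ?W)" by (rule openin_open_Int)
    moreover have "?G \<in> ?X \<inter> ?W"
      using GX by (auto simp: moment_centroids[OF nd d] bary_facet_centroid[OF d])
    moreover have "immobilizes p v" if "p \<in> ?X \<inter> ?W" for p
      using that unfolding X by (intro near_centroids_immobilizes[OF nd d, of p ?s]) auto
    ultimately show ?thesis by blast
  qed
  ultimately show ?thesis by blast
qed

end
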